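(* Let $k_2>0$ and $N\in\mathbb{N}$. Let $(\lambda(k))_{k>0}\subset\Lambda_N$ be a family of partitions such that $(\lambda(k)/k)_{k>0}$ is bounded. Then, locally uniformly for $x\in C_N^B$, $$\big(P^{(1/k_2)}_{\lambda(k)}(x)\big)^{1/k}-\prod_{i=1}^N x_i^{\lambda(k)_i/k}\ \longrightarrow\ 0\qquad\text{for } k\to\infty.$$
   Context: $C_N^B:=\{x\in\mathbb{R}^N: x_1\ge\ldots\ge x_N\ge0\}$ and $\Lambda_N:=C_N^B\cap\mathbb{Z}^N$ is the set of partitions of length at most $N$; $|\lambda|=\sum_i\lambda_i$. The dominance order is $\mu\le\lambda$ iff $|\mu|=|\lambda|$ and $\sum_{j=1}^i\mu_j\le\sum_{j=1}^i\lambda_j$ for all $i$. The monomial symmetric polynomials are $m_\lambda(x)=\sum_{\mu\in S_N\lambda}x^\mu$ (sum over the orbit of $\lambda$ under the symmetric group $S_N$). For $\alpha>0$, the Jack polynomial $P^{(\alpha)}_\lambda$ (in $N$ variables) is the unique symmetric polynomial, homogeneous of degree $|\lambda|$, of the form $P^{(\alpha)}_\lambda=m_\lambda+\sum_{\mu\in\Lambda_N,\,\mu\le\lambda,\,\mu\ne\lambda}c_{\lambda,\mu}\,m_\mu$ with real coefficients $c_{\lambda,\mu}$ which is an eigenfunction of $$H_{1/\alpha}=\sum_{i=1}^N x_i^2\frac{\partial^2}{\partial x_i^2}+\frac{2}{\alpha}\sum_{i\ne j}\frac{x_i^2}{x_i-x_j}\frac{\partial}{\partial x_i}$$ with eigenvalue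 $\sum_{i=1}^N\lambda_i(\lambda_i-1+\frac{2}{\alpha}(N-i))$. The convention $0^0=1$ is used in $x_i^{\lambda(k)_i/k}$. *)

theory Defs
  imports "HOL-Analysis.Analysis" "HOL-Combinatorics.Permutations"
begin

text \<open>
  Vectors of length \<open>N\<close> are functions on \<open>nat\<close> that are read on the indices \<open>{1..N}\<close>.
  The elements of \<open>cone_B N\<close> and \<open>partitions N\<close> are extended by \<open>0\<close> outside \<open>{1..N}\<close>, so that
  the product topology of \<open>nat \<Rightarrow> real\<close> induces on \<open>cone_B N\<close> the Euclidean topology.
\<close>

definition cone_B :: "nat \<Rightarrow> (nat \<Rightarrow> real) set" where
  "cone_B N = {x. (\<forall>i\<in>{1..N}. \<forall>j\<in>{1..N}. i \<le> j \<longrightarrow> x j \<le> x i) \<and>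
                  (\<forall>i\<in>{1..N}. 0 \<le> x i) \<and> (\<forall>i. i \<notin> {1..N} \<longrightarrow> x i = 0)}"

definition partitions :: "nat \<Rightarrow> (nat \<Rightarrow> nat) set" where
  "partitions N = {l. (\<lambda>i. real (l i)) \<in> cone_B N}"

definition weight :: "nat \<Rightarrow> (nat \<Rightarrow> nat) \<Rightarrow> nat" where
  "weight N l = (\<Sum>i=1..N. l i)"

definition dominated :: "nat \<Rightarrow> (nat \<Rightarrow> nat) \<Rightarrow> (nat \<Rightarrow> nat) \<Rightarrow> bool" where
  "dominated N m l \<longleftrightarrow>
     weight N m = weight N l \<and> (\<forall>i\<in>{1..N}. (\<Sum>j=1..i. m j) \<le> (\<Sum>j=1..i. l j))"

definition orbit_S :: "nat \<Rightarrow> (nat \<Rightarrow> nat) \<Rightarrow> (nat \<Rightarrow> nat) set" where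
  "orbit_S N l = {l \<circ> p | p. p permutes {1..N}}"

definition monomial_sym :: "nat \<Rightarrow> (nat \<Rightarrow> nat) \<Rightarrow> (nat \<Rightarrow> real) \<Rightarrow> real" where
  "monomial_sym N l x = (\<Sum>m\<in>orbit_S N l. \<Prod>i=1..N. x i ^ m i)"

definition partial :: "nat \<Rightarrow> ((nat \<Rightarrow> real) \<Rightarrow> real) \<Rightarrow> (nat \<Rightarrow> real) \<Rightarrow> real" where
  "partial i f x = deriv (\<lambda>t. f (x(i := t))) (x i)"

text \<open>
  The operator \<open>H\<close> with parameter \<open>\<kappa> = 1/\<alpha>\<close>. Its coefficients are singular where two coordinates
  coincide (division by zero yields \<open>0\<close> there), so it is meaningful only at points with pairwise
  distinct coordinates.
\<close>

definition H_op :: "nat \<Rightarrow> real \<Rightarrow> ((nat \<Rightarrow> real) \<Rightarrow> real) \<Rightarrow> (nat \<Rightarrow> real) \<Rightarrow> real" where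
  "H_op N \<kappa> f x =
     (\<Sum>i=1..N. (x i)\<^sup>2 * partial i (partial i f) x) +
     2 * \<kappa> * (\<Sum>i=1..N. \<Sum>j\<in>{1..N} - {i}. (x i)\<^sup>2 / (x i - x j) * partial i f x)"

definition H_eigenvalue :: "nat \<Rightarrow> real \<Rightarrow> (nat \<Rightarrow> nat) \<Rightarrow> real" where
  "H_eigenvalue N \<kappa> l =
     (\<Sum>i=1..N. real (l i) * (real (l i) - 1 + 2 * \<kappa> * (real N - real i)))"

text \<open>
  Polynomials are identified with the functions they define. The eigenvalue equation is required on
  the dense open set of points with distinct coordinates, which determines it as an identity of
  polynomials. That a Jack polynomial is a polynomial in the coordinates \<open>{1..N}\<close> is part of the
  expansion into monomial symmetric polynomials.
\<close>

definition is_jack :: "nat \<Rightarrow> real \<Rightarrow> (nat \<Rightarrow> nat) \<Rightarrow> ((nat \<Rightarrow> real) \<Rightarrow> real) \<Rightarrow> bool" where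
  "is_jack N \<alpha> l P \<longleftrightarrow>
     (\<forall>p x. p permutes {1..N} \<longrightarrow> P (x \<circ> p) = P x) \<and>
     (\<forall>t x. P (\<lambda>i. t * x i) = t ^ weight N l * P x) \<and>
     (\<exists>c. P = (\<lambda>x. monomial_sym N l x +
        (\<Sum>m\<in>{m \<in> partitions N. dominated N m l \<and> m \<noteq> l}. c m * monomial_sym N m x))) \<and>
     (\<forall>x. inj_on x {1..N} \<longrightarrow> H_op N (1 / \<alpha>) P x = H_eigenvalue N (1 / \<alpha>) l * P x)"

definition jack :: "nat \<Rightarrow> real \<Rightarrow> (nat \<Rightarrow> nat) \<Rightarrow> (nat \<Rightarrow> real) \<Rightarrow> real" where
  "jack N \<alpha> l = (THE P. is_jack N \<alpha> l P)"

text \<open>Real powers of nonnegative numbers with \<open>0\<^sup>0 = 1\<close>, whereas \<open>0 powr 0 = 0\<close>.\<close>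

definition rpow :: "real \<Rightarrow> real \<Rightarrow> real" where
  "rpow x a = (if a = 0 then 1 else x powr a)"

end

theory Submission
  imports Defs "HOL-Real_Asymp.Real_Asymp"
begin

text \<open>
  A Jack polynomial is expanded as \<open>P = \<Sum>v. C v * x\<^sup>v\<close> over all exponent vectors \<open>v\<close> of weight
  \<open>|l|\<close>, with \<open>C\<close> constant on orbits, rather than over partitions only. In these terms the operator is
  explicit (\<open>H_op_symmetric\<close>): it multiplies \<open>C v\<close> by a number \<open>d(v)\<close> and adds contributions of the
  vectors that lie further out than \<open>v\<close> on a line in a direction \<open>e\<^sub>i - e\<^sub>j\<close>. As the monomials are
  linearly independent, the eigenvalue equation is the recursion
  \<open>(d(l) - d(v)) * C v = \<kappa> * (\<Sum>i \<noteq> j. \<Sum>t. (v\<^sub>i - v\<^sub>j + 2 * t) * C (v + t * (e\<^sub>i - e\<^sub>j)))\<close>.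
  For \<open>v\<close> majorized by \<open>l\<close> and outside its orbit, \<open>d(l) - d(v)\<close> is positive. So the recursion has exactly
  one solution with \<open>C l = 1\<close> that lives on the vectors majorized by \<open>l\<close>. This gives existence and
  uniqueness of the Jack polynomial and shows that its coefficients are nonnegative.

  The upper bound comes from the same recursion. Let \<open>E(v) = |l|\<^sup>2 - |v|\<^sup>2\<close>, which is at most
  \<open>d(l) - d(v)\<close>. The step from \<open>v\<close> to \<open>v + t * (e\<^sub>i - e\<^sub>j)\<close> lowers \<open>E\<close> by \<open>s(t) = 2 * t * (v\<^sub>i - v\<^sub>j + t)\<close>,
  and the factor \<open>v\<^sub>i - v\<^sub>j + 2 * t\<close> is at most the increment \<open>s(t) - s(t - 1)\<close>. If \<open>C u \<le> f(E(u))\<close> with an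
  increasing \<open>f\<close>, each inner sum is therefore a lower Riemann sum of the integral of \<open>f\<close> over \<open>[0, E(v)]\<close>,
  up to a boundary term. For \<open>f(E) = (E + 1)\<^sup>p\<close> this integral is of size \<open>(E + 1)\<^bsup>p + 1\<^esup> / (p + 1)\<close>, so the
  bound reproduces itself as soon as \<open>p\<close> is large compared with \<open>\<kappa> * N\<^sup>2\<close> (\<open>jack_coeff_le\<close>). Hence the
  coefficients grow only polynomially in \<open>|l|\<close>.

  On the cone, \<open>x\<^sup>v \<le> x\<^sup>l\<close> for every \<open>v\<close> majorized by \<open>l\<close>. Together this yields
  \<open>x\<^sup>l \<le> P(x) \<le> (|l| + 1)\<^sup>q * x\<^sup>l\<close> with an exponent \<open>q\<close> that depends on \<open>N\<close> and \<open>\<kappa>\<close> only. As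
  \<open>|\<lambda>(k)| = O(k)\<close>, the \<open>k\<close>-th root of the factor \<open>(|\<lambda>(k)| + 1)\<^sup>q\<close> tends to \<open>1\<close>.
\<close>

section \<open>Compositions, partitions and majorization\<close>

definition comps :: "nat \<Rightarrow> nat \<Rightarrow> (nat \<Rightarrow> nat) set" where
  "comps N n = {v. (\<forall>i. i \<notin> {1..N} \<longrightarrow> v i = 0) \<and> weight N v = n}"

text \<open>
  The extension of the dominance order to vectors that need not be sorted. Testing all index sets
  instead of the initial ones makes the condition invariant under permutations of \<open>v\<close>.
\<close>

definition majorized :: "nat \<Rightarrow> (nat \<Rightarrow> nat) \<Rightarrow> (nat \<Rightarrow> nat) \<Rightarrow> bool" where
  "majorized N v l \<longleftrightarrow> v \<in> comps N (weight N l) \<and> (\<forall>A\<subseteq>{1..N}. sum v A \<le> sum l {1..card A})"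

definition sq_norm :: "nat \<Rightarrow> (nat \<Rightarrow> nat) \<Rightarrow> nat" where
  "sq_norm N v = (\<Sum>i=1..N. (v i)\<^sup>2)"

lemma comps_le: "v \<in> comps N n \<Longrightarrow> v i \<le> n"
  using member_le_sum[of i "{1..N}" v] by (cases "i \<in> {1..N}") (auto simp: comps_def weight_def)

lemma comps_subset_funcs: "comps N n \<subseteq> {f. \<forall>i. (i \<in> {1..N} \<longrightarrow> f i \<in> {..n}) \<and> (i \<notin> {1..N} \<longrightarrow> f i = 0)}"
  using comps_le by (auto simp: comps_def)

lemma finite_comps [simp]: "finite (comps N n)"
  by (rule finite_subset[OF comps_subset_funcs finite_set_of_finite_funs]) auto

lemma card_comps_le: "card (comps N n) \<le> (n + 1) ^ N"
proof -
  have "comps N n \<subseteq> (\<lambda>f i. if i \<in> {1..N} then f i else 0) ` ({1..N} \<rightarrow>\<^sub>E {..n})"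
  proof
    fix v assume v: "v \<in> comps N n"
    show "v \<in> (\<lambda>f i. if i \<in> {1..N} then f i else 0) ` ({1..N} \<rightarrow>\<^sub>E {..n})"
      by (rule image_eqI[of _ _ "restrict v {1..N}"])
        (use v comps_le[OF v] in \<open>auto simp: comps_def fun_eq_iff\<close>)
  qed
  then have "card (comps N n) \<le> card ((\<lambda>f i. if i \<in> {1..N} then f i else 0) ` ({1..N} \<rightarrow>\<^sub>E {..n}))"
    by (intro card_mono finite_imageI finite_PiE) auto
  also have "\<dots> \<le> card ({1..N} \<rightarrow>\<^sub>E {..n})"
    by (intro card_image_le finite_PiE) auto
  also have "\<dots> = (n + 1) ^ N"
    by (simp add: card_PiE)
  finally show ?thesis .
qed

lemma sum_comp_permutes: "p permutes S \<Longrightarrow> (\<Sum>i\<in>S. f (v (p i))) = (\<Sum>i\<in>S. f (v i))"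
  using sum.permute[of p S "\<lambda>i. f (v i)"] by (simp add: o_def)

lemma comps_permute:
  assumes "p permutes {1..N}" "v \<in> comps N n"
  shows "v \<circ> p \<in> comps N n"
  using assms sum_comp_permutes[OF assms(1), of "\<lambda>x. x" v] permutes_not_in[OF assms(1)]
  by (auto simp: comps_def weight_def)

lemma sq_norm_permute: "p permutes {1..N} \<Longrightarrow> sq_norm N (v \<circ> p) = sq_norm N v"
  unfolding sq_norm_def using sum_comp_permutes[of p "{1..N}" "\<lambda>x. x\<^sup>2" v] by simp

lemma sq_norm_le: 
  assumes "v \<in> comps N n" shows "sq_norm N v \<le> n\<^sup>2"
proof -
  have "sq_norm N v \<le> (\<Sum>i=1..N. n * v i)"
    unfolding sq_norm_def power2_eq_square
    by (intro sum_mono mult_right_mono comps_le[OF assms]) auto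
  also have "\<dots> = n\<^sup>2"
    using assms by (simp add: comps_def weight_def sum_distrib_left[symmetric] power2_eq_square)
  finally show ?thesis .
qed

lemma partitions_iff:
  "l \<in> partitions N \<longleftrightarrow>
    (\<forall>i\<in>{1..N}. \<forall>j\<in>{1..N}. i \<le> j \<longrightarrow> l j \<le> l i) \<and> (\<forall>i. i \<notin> {1..N} \<longrightarrow> l i = 0)"
  by (auto simp: partitions_def cone_B_def)

lemma partition_in_comps: "l \<in> partitions N \<Longrightarrow> l \<in> comps N (weight N l)"
  by (auto simp: partitions_iff comps_def)

text \<open>
  Exchange \<open>A - {1..r}\<close> against \<open>{1..r} - A\<close>, where \<open>r = card A\<close>: both have the same size, and the value
  \<open>l r\<close> separates the entries of \<open>l\<close> on the two.
\<close>

lemma partition_sum_le_initial_sum: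
  assumes l: "l \<in> partitions N" and A: "A \<subseteq> {1..N}"
  shows "sum l A \<le> sum l {1..card A}"
proof -
  define r where "r = card A"
  have finA: "finite A" using A finite_subset by blast
  have rN: "r \<le> N" using card_mono[OF _ A] by (simp add: r_def)
  define I where "I = {1..r}"
  have cI: "card I = card A" "finite I" by (auto simp: I_def r_def)
  have ceq: "card (A - I) = card (I - A)"
    using card_Diff_subset_Int[of A I] card_Diff_subset_Int[of I A] cI finA by (simp add: Int_commute)
  have up: "sum l (A - I) \<le> card (A - I) * l r"
  proof -
    have "l i \<le> l r" if "i \<in> A - I" for i
    proof -
      have i: "i \<in> {1..N}" "r < i" using that A by (auto simp: I_def)
      have "A \<noteq> {}" using that by auto
      then have "r \<in> {1..N}" using rN finA by (simp add: r_def Suc_le_eq card_gt_0_iff)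
      with i l show ?thesis unfolding partitions_iff by (meson less_imp_le)
    qed
    then show ?thesis using sum_bounded_above[of "A - I" l "l r"] by simp
  qed
  have low: "card (I - A) * l r \<le> sum l (I - A)"
  proof -
    have "l r \<le> l i" if "i \<in> I - A" for i
      using that l rN by (auto simp: partitions_iff I_def)
    then show ?thesis using sum_bounded_below[of "I - A" "l r" l] by simp
  qed
  have "sum l A = sum l (A \<inter> I) + sum l (A - I)"
    using sum.Int_Diff[OF finA] by blast
  also have "\<dots> \<le> sum l (I \<inter> A) + sum l (I - A)"
    using up low ceq by (simp add: Int_commute)
  also have "\<dots> = sum l I"
    using sum.Int_Diff[OF cI(2)] by metis
  finally show ?thesis by (simp add: I_def r_def)
qed

text \<open>
  Each of two rearrangements that are both sorted has initial sums at least those of the other, so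
  the initial sums agree, hence so do the entries.
\<close>

lemma partition_permute_unique:
  assumes l: "l \<in> partitions N" and p: "p permutes {1..N}" and lp: "l \<circ> p \<in> partitions N"
  shows "l \<circ> p = l"
proof -
  have le: "sum (u \<circ> q) {1..r} \<le> sum u {1..r}"
    if u: "u \<in> partitions N" and q: "q permutes {1..N}" and r: "r \<le> N" for u q r
  proof -
    have inj: "inj_on q {1..r}" using permutes_inj[OF q] by (rule inj_on_subset) simp
    have "q ` {1..r} \<subseteq> {1..N}" using permutes_image[OF q] r by (metis atLeastatMost_subset_iff image_mono order_refl)
    then show ?thesis
      using partition_sum_le_initial_sum[OF u, of "q ` {1..r}"] inj
      by (simp add: sum.reindex card_image)
  qed
  have eq: "sum (l \<circ> p) {1..r} = sum l {1..r}" if "r \<le> N" for r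
  proof (rule antisym)
    show "sum (l \<circ> p) {1..r} \<le> sum l {1..r}" using le[OF l p that] .
    have "sum ((l \<circ> p) \<circ> inv p) {1..r} \<le> sum (l \<circ> p) {1..r}"
      using le[OF lp permutes_inv[OF p] that] .
    moreover have "(l \<circ> p) \<circ> inv p = l"
      using permutes_inv_o(1)[OF p] by (simp add: o_assoc[symmetric])
    ultimately show "sum l {1..r} \<le> sum (l \<circ> p) {1..r}" by metis
  qed
  show ?thesis
  proof
    fix i show "(l \<circ> p) i = l i"
    proof (cases "i \<in> {1..N}")
      case True
      then obtain r where r: "i = Suc r" by (cases i) auto
      show ?thesis using eq[of i] eq[of r] True by (simp add: r)
    next
      case False
      then show ?thesis using permutes_not_in[OF p] by simp
    qed
  qed
qed

text \<open>
  A permutation that minimizes \<open>\<Sum>i. i * v (p i)\<close> sorts \<open>v\<close>: exchanging two entries in the wrong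
  order would make the sum smaller.
\<close>

lemma ex_sorting_permutation:
  assumes v: "\<And>i. i \<notin> {1..N} \<Longrightarrow> v i = 0"
  shows "\<exists>p. p permutes {1..N} \<and> v \<circ> p \<in> partitions N"
proof -
  obtain p where p: "p permutes {1..N}"
    and min: "\<And>q. q permutes {1..N} \<Longrightarrow> (\<Sum>i=1..N. i * v (p i)) \<le> (\<Sum>i=1..N. i * v (q i))"
    using ex_has_least_nat[of "\<lambda>p. p permutes {1..N}" id "\<lambda>p. \<Sum>i=1..N. i * v (p i)"] permutes_id
    by metis
  have "v (p j) \<le> v (p i)" if ij: "i \<in> {1..N}" "j \<in> {1..N}" "i \<le> j" for i j
  proof (rule ccontr)
    assume less: "\<not> v (p j) \<le> v (p i)"
    then have "i < j" using ij by (metis le_neq_implies_less order_refl)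
    define q where "q = p \<circ> Transposition.transpose i j"
    have q: "q permutes {1..N}" unfolding q_def
      using ij by (intro permutes_compose permutes_swap_id p) auto
    have split: "(\<Sum>k=1..N. k * f k) = i * f i + j * f j + (\<Sum>k\<in>{1..N} - {i} - {j}. k * f k)" for f :: "nat \<Rightarrow> nat"
      using ij \<open>i < j\<close> sum.remove[of "{1..N}" i "\<lambda>k. k * f k"]
        sum.remove[of "{1..N} - {i}" j "\<lambda>k. k * f k"] by simp
    have "(\<Sum>k\<in>{1..N} - {i} - {j}. k * v (q k)) = (\<Sum>k\<in>{1..N} - {i} - {j}. k * v (p k))"
      by (intro sum.cong) (auto simp: q_def transpose_def)
    then have "i * v (p i) + j * v (p j) \<le> i * v (p j) + j * v (p i)"
      using min[OF q] split[of "\<lambda>k. v (p k)"] split[of "\<lambda>k. v (q k)"]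
      by (simp add: q_def)
    moreover obtain a b where "j = i + Suc a" "v (p j) = v (p i) + Suc b"
      using \<open>i < j\<close> less by (metis less_iff_Suc_add not_le add_Suc_right)
    ultimately show False by (simp add: algebra_simps)
  qed
  moreover have "(v \<circ> p) i = 0" if "i \<notin> {1..N}" for i
    using that v permutes_not_in[OF p] by simp
  ultimately have "v \<circ> p \<in> partitions N" by (auto simp: partitions_iff)
  with p show ?thesis by blast
qed

lemma orbit_S_refl: "l \<in> orbit_S N l"
  unfolding orbit_S_def using permutes_id[of "{1..N}"] by (auto intro!: exI[of _ id])

lemma orbit_S_sym: "m \<in> orbit_S N l \<Longrightarrow> l \<in> orbit_S N m"
proof -
  assume "m \<in> orbit_S N l"
  then obtain p where p: "p permutes {1..N}" "m = l \<circ> p" by (auto simp: orbit_S_def)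
  have "l = m \<circ> inv p"
    using permutes_inv_o(1)[OF p(1)] p(2) by (simp add: o_assoc[symmetric])
  then show ?thesis using permutes_inv[OF p(1)] by (auto simp: orbit_S_def)
qed

lemma orbit_S_trans: "m \<in> orbit_S N l \<Longrightarrow> u \<in> orbit_S N m \<Longrightarrow> u \<in> orbit_S N l"
  unfolding orbit_S_def by (auto simp: o_assoc[symmetric] intro: permutes_compose)

lemma orbit_S_permute_iff: "p permutes {1..N} \<Longrightarrow> v \<circ> p \<in> orbit_S N l \<longleftrightarrow> v \<in> orbit_S N l"
proof -
  assume p: "p permutes {1..N}"
  then have "v \<circ> p \<in> orbit_S N v" by (auto simp: orbit_S_def)
  then show ?thesis using orbit_S_trans orbit_S_sym by blast
qed

definition sorted_comp :: "nat \<Rightarrow> (nat \<Rightarrow> nat) \<Rightarrow> (nat \<Rightarrow> nat)" where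
  "sorted_comp N v = (SOME m. m \<in> partitions N \<and> m \<in> orbit_S N v)"

lemma sorted_comp:
  assumes "v \<in> comps N n"
  shows sorted_comp_partition: "sorted_comp N v \<in> partitions N"
    and sorted_comp_orbit: "sorted_comp N v \<in> orbit_S N v"
proof -
  have "\<exists>m. m \<in> partitions N \<and> m \<in> orbit_S N v"
    using assms ex_sorting_permutation[of N v] by (auto simp: comps_def orbit_S_def)
  from someI_ex[OF this] show "sorted_comp N v \<in> partitions N" "sorted_comp N v \<in> orbit_S N v"
    by (auto simp: sorted_comp_def)
qed

lemma comps_orbit: "v \<in> comps N n \<Longrightarrow> m \<in> orbit_S N v \<Longrightarrow> m \<in> comps N n"
  by (auto simp: orbit_S_def intro: comps_permute)

lemma sorted_comp_eq_iff:
  assumes v: "v \<in> comps N n" and m: "m \<in> partitions N"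
  shows "sorted_comp N v = m \<longleftrightarrow> v \<in> orbit_S N m"
proof
  assume "sorted_comp N v = m"
  then show "v \<in> orbit_S N m" using orbit_S_sym sorted_comp_orbit[OF v] by blast
next
  assume "v \<in> orbit_S N m"
  then have "sorted_comp N v \<in> orbit_S N m" using orbit_S_trans sorted_comp_orbit[OF v] by blast
  then obtain p where "p permutes {1..N}" "sorted_comp N v = m \<circ> p" by (auto simp: orbit_S_def)
  then show "sorted_comp N v = m"
    using partition_permute_unique[OF m] sorted_comp_partition[OF v] by metis
qed

lemma majorized_permute:
  assumes p: "p permutes {1..N}" and v: "majorized N v l"
  shows "majorized N (v \<circ> p) l"
proof -
  have "sum (v \<circ> p) A \<le> sum l {1..card A}" if A: "A \<subseteq> {1..N}" for A
  proof -
    have inj: "inj_on p A" using permutes_inj[OF p] by (rule inj_on_subset) simp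
    have "p ` A \<subseteq> {1..N}" using permutes_image[OF p] A by blast
    then have "sum v (p ` A) \<le> sum l {1..card (p ` A)}"
      using v by (auto simp: majorized_def)
    then show ?thesis using inj by (simp add: sum.reindex card_image)
  qed
  then show ?thesis using v comps_permute[OF p] by (auto simp: majorized_def)
qed

lemma majorized_orbit_iff:
  assumes "m \<in> orbit_S N v" shows "majorized N m l \<longleftrightarrow> majorized N v l"
proof -
  have "majorized N u l" if "majorized N w l" "u \<in> orbit_S N w" for u w
    using that majorized_permute by (auto simp: orbit_S_def)
  then show ?thesis using assms orbit_S_sym by blast
qed

lemma majorized_iff_dominated:
  assumes m: "m \<in> partitions N"
  shows "majorized N m l \<longleftrightarrow> dominated N m l"
proof
  assume M: "majorized N m l"
  then have "(\<Sum>j=1..i. m j) \<le> (\<Sum>j=1..i. l j)" if "i \<in> {1..N}" for i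
    using that by (auto simp: majorized_def dest: spec[of _ "{1..i}"])
  then show "dominated N m l" using M by (auto simp: dominated_def majorized_def comps_def)
next
  assume D: "dominated N m l"
  have "sum m A \<le> sum l {1..card A}" if A: "A \<subseteq> {1..N}" for A
  proof -
    have "card A \<le> N" using card_mono[OF _ A] by simp
    then have "sum m {1..card A} \<le> sum l {1..card A}"
      using D by (cases "card A = 0") (auto simp: dominated_def)
    then show ?thesis using partition_sum_le_initial_sum[OF m A] by linarith
  qed
  then show "majorized N m l"
    using D partition_in_comps[OF m] by (auto simp: majorized_def dominated_def)
qed

text \<open>
  Summation by parts: the left-hand side is the boundary term, and the remaining terms are products
  of a decrement of \<open>g\<close> and an initial sum of \<open>a\<close>.
\<close>

lemma sum_mult_decreasing_ge:
  fixes g a :: "nat \<Rightarrow> real"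
  assumes "\<And>i. 1 \<le> i \<Longrightarrow> i < n \<Longrightarrow> g (Suc i) \<le> g i"
    and "\<And>r. r \<le> n \<Longrightarrow> 0 \<le> sum a {1..r}"
  shows "g n * sum a {1..n} \<le> (\<Sum>i=1..n. g i * a i)"
  using assms
proof (induction n)
  case (Suc n)
  have IH: "g n * sum a {1..n} \<le> (\<Sum>i=1..n. g i * a i)"
    using Suc by auto
  have "g (Suc n) * sum a {1..n} \<le> g n * sum a {1..n}"
    using Suc.prems(1)[of n] Suc.prems(2)[of n] by (cases "n = 0") (auto intro: mult_right_mono)
  with IH show ?case by (simp add: algebra_simps)
qed auto

lemma dominated_sum_mult_le:
  fixes g :: "nat \<Rightarrow> real"
  assumes D: "dominated N m l" and g: "\<And>i. 1 \<le> i \<Longrightarrow> i < N \<Longrightarrow> g (Suc i) \<le> g i"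
  shows "(\<Sum>i=1..N. g i * real (m i)) \<le> (\<Sum>i=1..N. g i * real (l i))"
proof -
  have "0 \<le> (\<Sum>i=1..r. real (l i) - real (m i))" if "r \<le> N" for r
  proof -
    have "sum m {1..r} \<le> sum l {1..r}"
      using D that by (cases "r = 0") (auto simp: dominated_def)
    then have "real (sum m {1..r}) \<le> real (sum l {1..r})" by (rule of_nat_mono)
    then show ?thesis by (simp add: sum_subtractf)
  qed
  from sum_mult_decreasing_ge[where g = g and n = N, OF g this]
  have "g N * (\<Sum>i=1..N. real (l i) - real (m i)) \<le> (\<Sum>i=1..N. g i * (real (l i) - real (m i)))"
    by blast
  moreover have "(\<Sum>i=1..N. real (l i) - real (m i)) = 0"
  proof -
    have "real (weight N m) = real (weight N l)" using D by (simp add: dominated_def)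
    then show ?thesis by (simp add: weight_def sum_subtractf)
  qed
  ultimately show ?thesis by (simp add: right_diff_distrib sum_subtractf)
qed

text \<open>
  \<open>|l|\<^sup>2 - |m|\<^sup>2 = |l - m|\<^sup>2 + 2 * (m \<bullet> (l - m))\<close>, and the inner product is nonnegative because \<open>m\<close> is
  decreasing and the initial sums of \<open>l - m\<close> are nonnegative.
\<close>

lemma dominated_sq_norm:
  assumes m: "m \<in> partitions N" and D: "dominated N m l"
  shows "(\<Sum>i=1..N. (real (l i) - real (m i))\<^sup>2) \<le> real (sq_norm N l) - real (sq_norm N m)"
proof -
  define a b where "a = (\<Sum>i=1..N. real (m i) * real (m i))" and "b = (\<Sum>i=1..N. real (m i) * real (l i))"
  have "a \<le> b" unfolding a_def b_def
    by (rule dominated_sum_mult_le[OF D]) (use m in \<open>auto simp: partitions_iff\<close>)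
  moreover have "(\<Sum>i=1..N. (real (l i) - real (m i))\<^sup>2) = real (sq_norm N l) - real (sq_norm N m)
      - 2 * (b - a)"
    unfolding a_def b_def sq_norm_def of_nat_sum sum_subtractf[symmetric] sum_distrib_left
    by (intro sum.cong refl) (simp add: power2_eq_square algebra_simps)
  ultimately show ?thesis by simp
qed

text \<open>
  The coefficient with which the operator maps \<open>x\<^sup>v\<close> to itself within a symmetric polynomial. It
  extends the eigenvalue from partitions to all vectors as a permutation invariant function.
\<close>

definition diag_coeff :: "nat \<Rightarrow> real \<Rightarrow> (nat \<Rightarrow> nat) \<Rightarrow> real" where
  "diag_coeff N \<kappa> v = (\<Sum>i=1..N. real (v i) * (real (v i) - 1)) +
     \<kappa> * (\<Sum>i=1..N. \<Sum>j\<in>{1..N} - {i}. real (max (v i) (v j)))"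

lemma sum_off_diagonal_permute:
  assumes p: "p permutes {1..N}"
  shows "(\<Sum>i=1..N. \<Sum>j\<in>{1..N} - {i}. f (p i) (p j)) = (\<Sum>i=1..N. \<Sum>j\<in>{1..N} - {i}. f i j)"
proof -
  have "(\<Sum>j\<in>{1..N} - {i}. f (p i) (p j)) = (\<Sum>j\<in>{1..N} - {p i}. f (p i) j)" if "i \<in> {1..N}" for i
  proof (rule sum.reindex_bij_betw)
    have "p ` ({1..N} - {i}) = {1..N} - {p i}"
      using permutes_image[OF p] image_set_diff[OF permutes_inj[OF p], of "{1..N}" "{i}"] by simp
    then show "bij_betw p ({1..N} - {i}) ({1..N} - {p i})"
      using permutes_inj[OF p] by (auto simp: bij_betw_def intro: inj_on_subset)
  qed
  then have "(\<Sum>i=1..N. \<Sum>j\<in>{1..N} - {i}. f (p i) (p j)) = (\<Sum>i=1..N. \<Sum>j\<in>{1..N} - {p i}. f (p i) j)"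
    by (rule sum.cong[OF refl])
  also have "\<dots> = (\<Sum>i=1..N. \<Sum>j\<in>{1..N} - {i}. f i j)"
    using sum.permute[OF p, of "\<lambda>i. \<Sum>j\<in>{1..N} - {i}. f i j"] by (simp add: o_def)
  finally show ?thesis .
qed

lemma diag_coeff_permute:
  assumes p: "p permutes {1..N}"
  shows "diag_coeff N \<kappa> (v \<circ> p) = diag_coeff N \<kappa> v"
  using sum_comp_permutes[OF p, of "\<lambda>x. real x * (real x - 1)" v]
    sum_off_diagonal_permute[OF p, of "\<lambda>i j. real (max (v i) (v j))"]
  by (simp add: diag_coeff_def)

lemma diag_coeff_partition:
  assumes l: "l \<in> partitions N"
  shows "diag_coeff N \<kappa> l = H_eigenvalue N \<kappa> l"
proof -
  have split: "(\<Sum>j\<in>{1..N} - {i}. real (max (l i) (l j)))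
      = (\<Sum>j=1..N. if j < i then real (l j) else 0) + (real N - real i) * real (l i)"
    if i: "i \<in> {1..N}" for i
  proof -
    have "(\<Sum>j\<in>{1..N} - {i}. real (max (l i) (l j)))
        = (\<Sum>j\<in>{1..N} - {i}. (if j < i then real (l j) else 0) + (if i < j then real (l i) else 0))"
      using l i by (intro sum.cong) (auto simp: partitions_iff max_def intro: antisym)
    also have "\<dots> = (\<Sum>j=1..N. (if j < i then real (l j) else 0) + (if i < j then real (l i) else 0))"
      using i by (simp add: sum_diff1)
    moreover have "(\<Sum>j=1..N. (if i < j then real (l i) else 0)) = (real N - real i) * real (l i)"
    proof -
      have "(\<Sum>j=1..N. (if i < j then real (l i) else 0)) = (\<Sum>j\<in>{i<..N}. real (l i))"
        using i by (intro sum.mono_neutral_cong_right) auto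
      then show ?thesis using i by (simp add: of_nat_diff)
    qed
    ultimately show ?thesis by (simp add: sum.distrib)
  qed
  have "(\<Sum>i=1..N. \<Sum>j=1..N. if j < i then real (l j) else 0)
      = (\<Sum>j=1..N. \<Sum>i=1..N. if j < i then real (l j) else 0)"
    by (rule sum.swap)
  also have "\<dots> = (\<Sum>j=1..N. (real N - real j) * real (l j))"
  proof (intro sum.cong refl)
    fix j assume j: "j \<in> {1..N}"
    have "(\<Sum>i=1..N. (if j < i then real (l j) else 0)) = (\<Sum>i\<in>{j<..N}. real (l j))"
      using j by (intro sum.mono_neutral_cong_right) auto
    then show "(\<Sum>i=1..N. (if j < i then real (l j) else 0)) = (real N - real j) * real (l j)"
      using j by (simp add: of_nat_diff)
  qed
  finally have "(\<Sum>i=1..N. \<Sum>j\<in>{1..N} - {i}. real (max (l i) (l j)))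
      = 2 * (\<Sum>i=1..N. (real N - real i) * real (l i))"
    using split by (simp add: sum.distrib)
  then have "diag_coeff N \<kappa> l = (\<Sum>i=1..N. real (l i) * (real (l i) - 1))
      + 2 * \<kappa> * (\<Sum>i=1..N. (real N - real i) * real (l i))"
    by (simp add: diag_coeff_def)
  then show ?thesis
    by (simp add: H_eigenvalue_def algebra_simps sum_distrib_left flip: sum.distrib)
qed

text \<open>
  Besides the squares, the eigenvalue contains \<open>\<Sum>i. (N - i) * l i\<close>, the sum of all proper initial
  sums of \<open>l\<close>, which is monotone in the dominance order. The remaining terms \<open>- |l|\<close> and \<open>- |m|\<close> are equal.
\<close>

lemma sq_norm_diff_le_diag_diff_dominated:
  assumes "m \<in> partitions N" "l \<in> partitions N" "dominated N m l" "\<kappa> \<ge> 0"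
  shows "real (sq_norm N l) - real (sq_norm N m) \<le> diag_coeff N \<kappa> l - diag_coeff N \<kappa> m"
proof -
  have "(\<Sum>i=1..N. (real N - real i) * real (m i)) \<le> (\<Sum>i=1..N. (real N - real i) * real (l i))"
    by (rule dominated_sum_mult_le[OF assms(3)]) auto
  then have "\<kappa> * (\<Sum>i=1..N. (real N - real i) * real (m i)) \<le> \<kappa> * (\<Sum>i=1..N. (real N - real i) * real (l i))"
    using assms(4) by (rule mult_left_mono)
  moreover have "(\<Sum>i=1..N. real (m i)) = (\<Sum>i=1..N. real (l i))"
    using assms(3) by (simp add: dominated_def weight_def flip: of_nat_sum)
  moreover have "diag_coeff N \<kappa> u = real (sq_norm N u) - (\<Sum>i=1..N. real (u i))
      + 2 * (\<kappa> * (\<Sum>i=1..N. (real N - real i) * real (u i)))" if "u \<in> partitions N" for u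
    unfolding diag_coeff_partition[OF that] H_eigenvalue_def sq_norm_def of_nat_sum
      sum_distrib_left sum_subtractf[symmetric] sum.distrib[symmetric]
    by (intro sum.cong refl) (simp add: power2_eq_square algebra_simps)
  ultimately show ?thesis using assms(1,2) by simp
qed

text \<open>Transfers the inequalities for partitions to all majorized vectors.\<close>

lemma majorized_sorted:
  assumes "majorized N v l"
  obtains m where "m \<in> partitions N" "dominated N m l" "m \<in> orbit_S N v"
    "sq_norm N m = sq_norm N v" "\<And>\<kappa>. diag_coeff N \<kappa> m = diag_coeff N \<kappa> v"
proof -
  have v: "v \<in> comps N (weight N l)" using assms by (simp add: majorized_def)
  define m where "m = sorted_comp N v"
  have m: "m \<in> partitions N" "m \<in> orbit_S N v"
    using sorted_comp[OF v] by (simp_all add: m_def)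
  then have "dominated N m l"
    using assms majorized_iff_dominated majorized_orbit_iff by blast
  moreover have "sq_norm N m = sq_norm N v" "diag_coeff N \<kappa> m = diag_coeff N \<kappa> v" for \<kappa>
    using m(2) by (auto simp: orbit_S_def sq_norm_permute diag_coeff_permute)
  ultimately show ?thesis using that m by blast
qed

lemma sq_norm_diff_le_diag_diff:
  assumes "majorized N v l" "l \<in> partitions N" "\<kappa> \<ge> 0"
  shows "real (sq_norm N l) - real (sq_norm N v) \<le> diag_coeff N \<kappa> l - diag_coeff N \<kappa> v"
  using majorized_sorted[OF assms(1)] sq_norm_diff_le_diag_diff_dominated assms(2,3) by metis

lemma majorized_sq_norm_le:
  assumes "majorized N v l"
  shows "sq_norm N v \<le> sq_norm N l"
proof -
  obtain m where m: "m \<in> partitions N" "dominated N m l" "sq_norm N m = sq_norm N v"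
    using majorized_sorted[OF assms] by metis
  have "0 \<le> (\<Sum>i=1..N. (real (l i) - real (m i))\<^sup>2)" by (intro sum_nonneg) auto
  then show ?thesis using dominated_sq_norm[OF m(1,2)] m(3) by simp
qed

lemma majorized_sq_norm_less:
  assumes v: "majorized N v l" and l: "l \<in> partitions N" and no: "v \<notin> orbit_S N l"
  shows "sq_norm N v < sq_norm N l"
proof -
  obtain m where m: "m \<in> partitions N" "dominated N m l" "m \<in> orbit_S N v" "sq_norm N m = sq_norm N v"
    using majorized_sorted[OF v] by metis
  have "m \<noteq> l" using no orbit_S_sym m(3) by blast
  then obtain i where i: "m i \<noteq> l i" by auto
  then have iN: "i \<in> {1..N}" using m(1) l unfolding partitions_iff by metis
  have "0 < (\<Sum>i=1..N. (real (l i) - real (m i))\<^sup>2)"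
    by (rule sum_pos2[OF _ iN]) (use i in auto)
  then show ?thesis using dominated_sq_norm[OF m(1,2)] m(4) by simp
qed

section \<open>The operator on symmetric polynomials\<close>

definition mpow :: "nat \<Rightarrow> (nat \<Rightarrow> nat) \<Rightarrow> (nat \<Rightarrow> real) \<Rightarrow> real" where
  "mpow N v x = (\<Prod>i=1..N. x i ^ v i)"

definition perm_invariant :: "nat \<Rightarrow> nat \<Rightarrow> ((nat \<Rightarrow> nat) \<Rightarrow> real) \<Rightarrow> bool" where
  "perm_invariant N n C \<longleftrightarrow> (\<forall>v\<in>comps N n. \<forall>p. p permutes {1..N} \<longrightarrow> C (v \<circ> p) = C v)"

definition shift :: "nat \<Rightarrow> nat \<Rightarrow> nat \<Rightarrow> (nat \<Rightarrow> nat) \<Rightarrow> (nat \<Rightarrow> nat)" where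
  "shift i j t v = v(i := v i + t, j := v j - t)"

text \<open>
  The \<open>t\<close> for which \<open>v\<close> lies strictly between \<open>u = shift i j t v\<close> and the vector obtained from \<open>u\<close>
  by swapping the entries \<open>i\<close> and \<open>j\<close>. The last condition is the relevant one when \<open>v i < v j\<close>: the
  shift has to lead beyond the mirror image of \<open>v\<close>.
\<close>

definition shifts :: "nat \<Rightarrow> nat \<Rightarrow> (nat \<Rightarrow> nat) \<Rightarrow> nat set" where
  "shifts i j v = {t. 1 \<le> t \<and> t \<le> v j \<and> v j < v i + t}"

text \<open>
  The off-diagonal part of the operator acting on coefficients. The sum runs over ordered pairs,
  so that each vector between \<open>u\<close> and its mirror image is reached once from \<open>u\<close> and once from
  the mirror image.
\<close>

definition raise_sum :: "nat \<Rightarrow> ((nat \<Rightarrow> nat) \<Rightarrow> real) \<Rightarrow> (nat \<Rightarrow> nat) \<Rightarrow> real" where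
  "raise_sum N C v = (\<Sum>i=1..N. \<Sum>j\<in>{1..N} - {i}. \<Sum>t\<in>shifts i j v.
     (real (v i) - real (v j) + 2 * real t) * C (shift i j t v))"

lemma finite_shifts [simp]: "finite (shifts i j v)"
  by (rule finite_subset[of _ "{..v j}"]) (auto simp: shifts_def)

lemma split_pair:
  fixes f :: "nat \<Rightarrow> 'a :: comm_monoid_add"
  assumes "i \<in> {1..N}" "j \<in> {1..N}" "i \<noteq> j"
  shows "(\<Sum>k=1..N. f k) = f i + (f j + (\<Sum>k\<in>{1..N} - {i} - {j}. f k))"
  using assms sum.remove[of "{1..N}" i f] sum.remove[of "{1..N} - {i}" j f] by simp

lemma prod_split_pair:
  fixes f :: "nat \<Rightarrow> 'a :: comm_monoid_mult"
  assumes "i \<in> {1..N}" "j \<in> {1..N}" "i \<noteq> j"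
  shows "(\<Prod>k=1..N. f k) = f i * (f j * (\<Prod>k\<in>{1..N} - {i} - {j}. f k))"
  using assms prod.remove[of "{1..N}" i f] prod.remove[of "{1..N} - {i}" j f] by simp

lemma shift_comps:
  assumes ij: "i \<in> {1..N}" "j \<in> {1..N}" "i \<noteq> j" and t: "t \<le> v j" and v: "v \<in> comps N n"
  shows "shift i j t v \<in> comps N n"
proof -
  have "(\<Sum>k\<in>{1..N} - {i} - {j}. shift i j t v k) = (\<Sum>k\<in>{1..N} - {i} - {j}. v k)"
    by (intro sum.cong) (auto simp: shift_def)
  then have "weight N (shift i j t v) = weight N v"
    unfolding weight_def split_pair[OF ij] using ij(3) t by (simp add: shift_def)
  then show ?thesis using v ij by (auto simp: comps_def shift_def)
qed

lemma sq_norm_shift: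
  assumes ij: "i \<in> {1..N}" "j \<in> {1..N}" "i \<noteq> j" and t: "t \<le> v j"
  shows "real (sq_norm N (shift i j t v))
    = real (sq_norm N v) + 2 * real t * (real (v i) - real (v j) + real t)"
proof -
  have "(\<Sum>k\<in>{1..N} - {i} - {j}. (shift i j t v k)\<^sup>2) = (\<Sum>k\<in>{1..N} - {i} - {j}. (v k)\<^sup>2)"
    by (intro sum.cong) (auto simp: shift_def)
  moreover obtain w where "v j = t + w" using t by (metis le_Suc_ex)
  ultimately show ?thesis
    unfolding sq_norm_def split_pair[OF ij] using ij(3)
    by (simp add: shift_def power2_eq_square algebra_simps)
qed

lemma sq_norm_shift_less:
  assumes "i \<in> {1..N}" "j \<in> {1..N}" "i \<noteq> j" "t \<in> shifts i j v"
  shows "sq_norm N v < sq_norm N (shift i j t v)"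
proof -
  have "real (v j) < real (v i) + real t" using assms(4) by (auto simp: shifts_def simp flip: of_nat_add)
  then have "0 < 2 * real t * (real (v i) - real (v j) + real t)"
    using assms(4) by (intro mult_pos_pos) (auto simp: shifts_def)
  moreover have "t \<le> v j" using assms(4) by (simp add: shifts_def)
  ultimately have "real (sq_norm N v) < real (sq_norm N (shift i j t v))"
    using sq_norm_shift[OF assms(1-3), of t v] by linarith
  then show ?thesis by simp
qed

text \<open>
  The factors \<open>a v\<close> stand for the powers of the other variables. Keeping them abstract lets the lemma
  be applied a second time to its own right-hand side.
\<close>

lemma partial_power_sum:
  assumes indep: "\<And>v x t. a v (x(i := t)) = a v x"
  shows "partial i (\<lambda>x. \<Sum>v\<in>K. a v x * x i ^ e v)
       = (\<lambda>x. \<Sum>v\<in>K. (a v x * real (e v)) * x i ^ (e v - 1))"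
proof
  fix x
  have "((\<lambda>t. \<Sum>v\<in>K. a v x * t ^ e v) has_field_derivative
      (\<Sum>v\<in>K. (a v x * real (e v)) * x i ^ (e v - 1))) (at (x i))"
    by (rule DERIV_sum) (auto intro!: derivative_eq_intros)
  then show "partial i (\<lambda>x. \<Sum>v\<in>K. a v x * x i ^ e v) x
       = (\<Sum>v\<in>K. (a v x * real (e v)) * x i ^ (e v - 1))"
    by (simp add: partial_def indep DERIV_imp_deriv)
qed

lemma euler_partial:
  fixes C :: "(nat \<Rightarrow> nat) \<Rightarrow> real" and K :: "(nat \<Rightarrow> nat) set"
  assumes i: "i \<in> {1..N}"
  defines "P \<equiv> (\<lambda>x. \<Sum>v\<in>K. C v * mpow N v x)"
  shows "x i * partial i P x = (\<Sum>v\<in>K. C v * real (v i) * mpow N v x)"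
    and "(x i)\<^sup>2 * partial i (partial i P) x
      = (\<Sum>v\<in>K. C v * (real (v i) * (real (v i) - 1)) * mpow N v x)"
proof -
  define a where "a v x = C v * (\<Prod>k\<in>{1..N} - {i}. x k ^ v k)" for v and x :: "nat \<Rightarrow> real"
  have indep: "a v (x(i := t)) = a v x" for v x t
    unfolding a_def by (intro arg_cong2[of _ _ _ _ "(*)"] prod.cong) auto
  have am: "C v * mpow N v x = a v x * x i ^ v i" for v x
    using i prod.remove[of "{1..N}" i "\<lambda>k. x k ^ v k"] by (simp add: mpow_def a_def)
  have P: "P = (\<lambda>x. \<Sum>v\<in>K. a v x * x i ^ v i)"
    by (simp add: P_def am)
  have P1: "partial i P = (\<lambda>x. \<Sum>v\<in>K. (a v x * real (v i)) * x i ^ (v i - 1))"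
    unfolding P by (rule partial_power_sum[OF indep])
  have P2: "partial i (partial i P)
      = (\<lambda>x. \<Sum>v\<in>K. (a v x * real (v i) * real (v i - 1)) * x i ^ (v i - 1 - 1))"
    unfolding P1 by (rule partial_power_sum) (simp add: indep)
  have "x i * (b * real e * x i ^ (e - 1)) = real e * (b * x i ^ e)" for e b
    by (cases e) auto
  then have "x i * partial i P x = (\<Sum>v\<in>K. real (v i) * (a v x * x i ^ v i))"
    unfolding P1 sum_distrib_left by (intro sum.cong refl)
  then show "x i * partial i P x = (\<Sum>v\<in>K. C v * real (v i) * mpow N v x)"
    by (simp add: am[symmetric] mult_ac)
  have "(x i)\<^sup>2 * (b * real e * real (e - 1) * x i ^ (e - 1 - 1)) = real e * (real e - 1) * (b * x i ^ e)" for e b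
  proof (cases e)
    case (Suc d) then show ?thesis by (cases d) (auto simp: power2_eq_square)
  qed auto
  then have "(x i)\<^sup>2 * partial i (partial i P) x
      = (\<Sum>v\<in>K. real (v i) * (real (v i) - 1) * (a v x * x i ^ v i))"
    unfolding P2 sum_distrib_left by (intro sum.cong refl)
  then show "(x i)\<^sup>2 * partial i (partial i P) x
      = (\<Sum>v\<in>K. C v * (real (v i) * (real (v i) - 1)) * mpow N v x)"
    by (simp add: am[symmetric] mult_ac)
qed

text \<open>
  The reason why the singular quotients are polynomials: the terms of \<open>v\<close> and of its mirror
  image together are divisible by \<open>X - Y\<close>. Apart from the two outer monomials, the quotient is a
  geometric sum, which telescopes after multiplication by \<open>X - Y\<close>.
\<close>

lemma two_variable_identity:
  fixes X Y :: real
  assumes "b < a"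
  shows "(a * X - b * Y) * (X ^ a * Y ^ b) + (b * X - a * Y) * (X ^ b * Y ^ a)
    = (X - Y) * (a * (X ^ a * Y ^ b) + a * (X ^ b * Y ^ a)
        + (real a - real b) * (\<Sum>t\<in>{1..<a - b}. X ^ (a - t) * Y ^ (b + t)))"
proof -
  have "(X - Y) * (\<Sum>t\<in>{1..<a - b}. X ^ (a - t) * Y ^ (b + t))
      = (\<Sum>t\<in>{1..<a - b}. - (X ^ (Suc a - Suc t) * Y ^ (b + Suc t)) - - (X ^ (Suc a - t) * Y ^ (b + t)))"
    unfolding sum_distrib_left
  proof (intro sum.cong refl)
    fix t assume t: "t \<in> {1..<a - b}"
    then have "Suc a - t = Suc (a - t)" using assms by (intro Suc_diff_le) auto
    then have "X ^ (Suc a - t) = X * X ^ (a - t)" by simp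
    then show "(X - Y) * (X ^ (a - t) * Y ^ (b + t))
      = - (X ^ (Suc a - Suc t) * Y ^ (b + Suc t)) - - (X ^ (Suc a - t) * Y ^ (b + t))"
      by (simp add: algebra_simps)
  qed
  also have "\<dots> = - (X ^ (Suc a - (a - b)) * Y ^ (b + (a - b))) - - (X ^ (Suc a - 1) * Y ^ (b + 1))"
    using assms by (intro sum_Suc_diff') simp
  also have "\<dots> = X ^ a * (Y * Y ^ b) - X * X ^ b * Y ^ a"
    using assms by (simp add: Suc_diff_le)
  finally have tele: "(X - Y) * (\<Sum>t\<in>{1..<a - b}. X ^ (a - t) * Y ^ (b + t))
    = X ^ a * (Y * Y ^ b) - X * X ^ b * Y ^ a" .
  have "(X - Y) * (a * (X ^ a * Y ^ b) + a * (X ^ b * Y ^ a)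
        + (real a - real b) * (\<Sum>t\<in>{1..<a - b}. X ^ (a - t) * Y ^ (b + t)))
     = (X - Y) * (a * (X ^ a * Y ^ b) + a * (X ^ b * Y ^ a))
      + (real a - real b) * ((X - Y) * (\<Sum>t\<in>{1..<a - b}. X ^ (a - t) * Y ^ (b + t)))"
    by (simp only: distrib_left mult.left_commute)
  also have "\<dots> = (a * X - b * Y) * (X ^ a * Y ^ b) + (b * X - a * Y) * (X ^ b * Y ^ a)"
    unfolding tele by (simp add: algebra_simps)
  finally show ?thesis by simp
qed

lemma mpow_permute:
  assumes "p permutes {1..N}"
  shows "mpow N (v \<circ> p) (x \<circ> p) = mpow N v x"
  using prod.permute[OF assms, of "\<lambda>i. x i ^ v i"] by (simp add: mpow_def o_def)

lemma bij_betw_comps_permute: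
  assumes p: "p permutes {1..N}"
  shows "bij_betw (\<lambda>v. v \<circ> p) (comps N n) (comps N n)"
proof (rule bij_betw_byWitness[where f' = "\<lambda>v. v \<circ> inv p"])
  show "\<forall>v\<in>comps N n. (v \<circ> p) \<circ> inv p = v" "\<forall>v\<in>comps N n. (v \<circ> inv p) \<circ> p = v"
    using permutes_inv_o[OF p] by (simp_all add: o_assoc[symmetric])
qed (use comps_permute p permutes_inv[OF p] in blast)+

text \<open>Pairs each vector with its mirror image under the swap of \<open>i\<close> and \<open>j\<close>.\<close>

lemma sum_comps_split_pair:
  fixes f :: "(nat \<Rightarrow> nat) \<Rightarrow> real"
  assumes ij: "i \<in> {1..N}" "j \<in> {1..N}"
  defines "s \<equiv> Transposition.transpose i j"
  shows "(\<Sum>v\<in>comps N n. f v) = (\<Sum>v | v \<in> comps N n \<and> v j < v i. f v + f (v \<circ> s))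
     + (\<Sum>v | v \<in> comps N n \<and> v i = v j. f v)"
proof -
  define K where "K = comps N n"
  have finK: "finite K" by (simp add: K_def)
  have s: "s permutes {1..N}" unfolding s_def using ij by (rule permutes_swap_id)
  have ss: "(v \<circ> s) \<circ> s = v" for v :: "nat \<Rightarrow> nat" by (auto simp: s_def fun_eq_iff)
  have swap: "(\<Sum>v | v \<in> K \<and> v i < v j. f v) = (\<Sum>v | v \<in> K \<and> v j < v i. f (v \<circ> s))"
    by (rule sum.reindex_bij_witness[where i = "\<lambda>v. v \<circ> s" and j = "\<lambda>v. v \<circ> s"])
      (use comps_permute[OF s] ss in \<open>auto simp: K_def s_def\<close>)
  have eq: "K = {v \<in> K. v j < v i} \<union> {v \<in> K. v i < v j} \<union> {v \<in> K. v i = v j}" by auto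
  have "sum f K = (\<Sum>v | v \<in> K \<and> v j < v i. f v) + (\<Sum>v | v \<in> K \<and> v i < v j. f v)
      + (\<Sum>v | v \<in> K \<and> v i = v j. f v)"
  proof -
    have "sum f ({v \<in> K. v j < v i} \<union> {v \<in> K. v i < v j} \<union> {v \<in> K. v i = v j})
      = sum f ({v \<in> K. v j < v i} \<union> {v \<in> K. v i < v j}) + sum f {v \<in> K. v i = v j}"
      using finK by (intro sum.union_disjoint) auto
    also have "sum f ({v \<in> K. v j < v i} \<union> {v \<in> K. v i < v j})
      = sum f {v \<in> K. v j < v i} + sum f {v \<in> K. v i < v j}"
      using finK by (intro sum.union_disjoint) auto
    finally show ?thesis using eq by simp
  qed
  then show ?thesis using swap by (simp add: sum.distrib K_def)
qed

text \<open>
  Collects contributions by target instead of source: \<open>v\<close> contributes to the vectors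
  \<open>shift j i t v\<close> below it, and \<open>u\<close> receives from the vectors \<open>shift i j t u\<close> above it.
\<close>

lemma sum_lower_eq_sum_raise:
  fixes g :: "(nat \<Rightarrow> nat) \<Rightarrow> (nat \<Rightarrow> nat) \<Rightarrow> real"
  assumes ij: "i \<in> {1..N}" "j \<in> {1..N}" "i \<noteq> j"
  shows "(\<Sum>v | v \<in> comps N n \<and> v j < v i. \<Sum>t\<in>{1..<v i - v j}.
       (real (v i) - real (v j)) * g v (shift j i t v))
     = (\<Sum>u\<in>comps N n. \<Sum>t\<in>shifts i j u. (real (u i) - real (u j) + 2 * real t) * g (shift i j t u) u)"
proof -
  define K where "K = {v \<in> comps N n. v j < v i}"
  have "(\<Sum>v\<in>K. \<Sum>t\<in>{1..<v i - v j}. (real (v i) - real (v j)) * g v (shift j i t v))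
     = (\<Sum>(v, t)\<in>Sigma K (\<lambda>v. {1..<v i - v j}). (real (v i) - real (v j)) * g v (shift j i t v))"
    by (rule sum.Sigma) (auto simp: K_def)
  also have "\<dots> = (\<Sum>(u, t)\<in>Sigma (comps N n) (shifts i j).
      (real (u i) - real (u j) + 2 * real t) * g (shift i j t u) u)"
  proof (rule sum.reindex_bij_witness[where i = "\<lambda>(u, t). (shift i j t u, t)"
        and j = "\<lambda>(v, t). (shift j i t v, t)"], goal_cases)
    case (1 a)
    then show ?case using ij by (auto simp: shift_def fun_eq_iff)
  next
    case (2 a)
    then show ?case
      using ij shift_comps[of j N i] by (auto simp: K_def shifts_def shift_def)
  next
    case (3 b)
    then show ?case using ij by (auto simp: shift_def shifts_def fun_eq_iff)
  next
    case (4 b)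
    then show ?case
      using ij shift_comps[of i N j] by (auto simp: K_def shifts_def shift_def)
  next
    case (5 a)
    obtain v t where a: "a = (v, t)" by (cases a)
    have "shift i j t (shift j i t v) = v"
      using 5 ij by (auto simp: a shift_def fun_eq_iff)
    moreover have "real (shift j i t v i) - real (shift j i t v j) + 2 * real t = real (v i) - real (v j)"
      using 5 ij by (auto simp: a shift_def of_nat_diff)
    ultimately show ?case by (simp add: a)
  qed
  also have "\<dots> = (\<Sum>u\<in>comps N n. \<Sum>t\<in>shifts i j u. (real (u i) - real (u j) + 2 * real t) * g (shift i j t u) u)"
    by (rule sum.Sigma[symmetric]) auto
  finally show ?thesis by (simp add: K_def)
qed

text \<open>
  Symmetry of \<open>C\<close> allows each \<open>v\<close> with \<open>v j < v i\<close> to be combined with its mirror image, and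
  \<open>two_variable_identity\<close> divides the result by \<open>x i - x j\<close>.
\<close>

lemma pair_interaction:
  fixes x :: "nat \<Rightarrow> real"
  assumes ij: "i \<in> {1..N}" "j \<in> {1..N}" "i \<noteq> j" and C: "perm_invariant N n C"
  shows "x i * (\<Sum>v\<in>comps N n. C v * real (v i) * mpow N v x)
       - x j * (\<Sum>v\<in>comps N n. C v * real (v j) * mpow N v x)
     = (x i - x j) * ((\<Sum>v\<in>comps N n. C v * real (max (v i) (v j)) * mpow N v x)
       + (\<Sum>v\<in>comps N n. \<Sum>t\<in>shifts i j v.
            (real (v i) - real (v j) + 2 * real t) * (C (shift i j t v) * mpow N v x)))"
    (is "?L = (x i - x j) * (?M + ?R)")
proof -
  define s where "s = Transposition.transpose i j"
  have s: "s permutes {1..N}" unfolding s_def using ij(1,2) by (rule permutes_swap_id)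
  have sij: "s i = j" "s j = i" by (auto simp: s_def)
  have Cs: "C (v \<circ> s) = C v" if "v \<in> comps N n" for v
    using C s that by (auto simp: perm_invariant_def)
  define W where "W v = (\<Prod>k\<in>{1..N} - {i} - {j}. x k ^ v k)" for v
  have Ws: "W (v \<circ> s) = W v" for v
    unfolding W_def by (intro prod.cong) (auto simp: s_def transpose_def)
  have Wl: "W (shift j i t v) = W v" for t v
    unfolding W_def by (intro prod.cong) (auto simp: shift_def)
  have mp: "mpow N v x = x i ^ v i * x j ^ v j * W v" for v
    unfolding mpow_def prod_split_pair[OF ij] by (simp add: W_def)
  define h where "h v = C v * (real (v i) * x i - real (v j) * x j) * mpow N v x" for v
  define m where "m v = C v * real (max (v i) (v j)) * mpow N v x" for v
  have "?L = (\<Sum>v\<in>comps N n. h v)"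
    unfolding sum_distrib_left sum_subtractf[symmetric] h_def
    by (intro sum.cong refl) (simp add: algebra_simps)
  also have "\<dots> = (\<Sum>v | v \<in> comps N n \<and> v j < v i. h v + h (v \<circ> s))
     + (\<Sum>v | v \<in> comps N n \<and> v i = v j. h v)"
    unfolding s_def by (rule sum_comps_split_pair[OF ij(1,2)])
  also have "(\<Sum>v | v \<in> comps N n \<and> v i = v j. h v)
      = (x i - x j) * (\<Sum>v | v \<in> comps N n \<and> v i = v j. m v)"
    unfolding sum_distrib_left
    by (intro sum.cong refl) (auto simp: h_def m_def algebra_simps)
  also have "(\<Sum>v | v \<in> comps N n \<and> v j < v i. h v + h (v \<circ> s))
     = (\<Sum>v | v \<in> comps N n \<and> v j < v i. (x i - x j) * ((m v + m (v \<circ> s))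
         + (\<Sum>t\<in>{1..<v i - v j}. (real (v i) - real (v j)) * (C v * mpow N (shift j i t v) x))))"
  proof (intro sum.cong refl)
    fix v assume "v \<in> {v \<in> comps N n. v j < v i}"
    then have v: "v \<in> comps N n" and lt: "v j < v i" by auto
    have low: "(\<Sum>t\<in>{1..<v i - v j}. (real (v i) - real (v j)) * (C v * mpow N (shift j i t v) x))
       = C v * W v * ((real (v i) - real (v j)) * (\<Sum>t\<in>{1..<v i - v j}. x i ^ (v i - t) * x j ^ (v j + t)))"
      unfolding sum_distrib_left mp Wl using ij
      by (intro sum.cong refl) (simp add: shift_def algebra_simps)
    have "h v + h (v \<circ> s) = C v * W v *
       ((real (v i) * x i - real (v j) * x j) * (x i ^ v i * x j ^ v j)
        + (real (v j) * x i - real (v i) * x j) * (x i ^ v j * x j ^ v i))"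
      by (simp add: h_def mp Cs[OF v] sij Ws algebra_simps)
    also have "\<dots> = (x i - x j) * (C v * W v * (real (v i) * (x i ^ v i * x j ^ v j)
         + real (v i) * (x i ^ v j * x j ^ v i)
         + (real (v i) - real (v j)) * (\<Sum>t\<in>{1..<v i - v j}. x i ^ (v i - t) * x j ^ (v j + t))))"
      unfolding two_variable_identity[OF lt] by (simp only: mult.left_commute)
    also have "C v * W v * (real (v i) * (x i ^ v i * x j ^ v j)
         + real (v i) * (x i ^ v j * x j ^ v i)
         + (real (v i) - real (v j)) * (\<Sum>t\<in>{1..<v i - v j}. x i ^ (v i - t) * x j ^ (v j + t)))
       = (m v + m (v \<circ> s)) + C v * W v * ((real (v i) - real (v j)) * (\<Sum>t\<in>{1..<v i - v j}. x i ^ (v i - t) * x j ^ (v j + t)))"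
      using lt by (simp add: m_def mp Cs[OF v] sij Ws distrib_left max_def mult.assoc mult.left_commute)
    finally show "h v + h (v \<circ> s) = (x i - x j) * ((m v + m (v \<circ> s))
         + (\<Sum>t\<in>{1..<v i - v j}. (real (v i) - real (v j)) * (C v * mpow N (shift j i t v) x)))"
      unfolding low .
  qed
  also have "\<dots> + (x i - x j) * (\<Sum>v | v \<in> comps N n \<and> v i = v j. m v)
     = (x i - x j) * (((\<Sum>v | v \<in> comps N n \<and> v j < v i. m v + m (v \<circ> s))
           + (\<Sum>v | v \<in> comps N n \<and> v i = v j. m v))
         + (\<Sum>v | v \<in> comps N n \<and> v j < v i. \<Sum>t\<in>{1..<v i - v j}.
              (real (v i) - real (v j)) * (C v * mpow N (shift j i t v) x)))"
    by (simp only: sum_distrib_left[symmetric] sum.distrib distrib_left add_ac)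
  also have "(\<Sum>v | v \<in> comps N n \<and> v j < v i. m v + m (v \<circ> s)) + (\<Sum>v | v \<in> comps N n \<and> v i = v j. m v) = ?M"
    unfolding s_def sum_comps_split_pair[OF ij(1,2), symmetric] by (simp add: m_def)
  also have "(\<Sum>v | v \<in> comps N n \<and> v j < v i. \<Sum>t\<in>{1..<v i - v j}.
              (real (v i) - real (v j)) * (C v * mpow N (shift j i t v) x)) = ?R"
    by (rule sum_lower_eq_sum_raise[OF ij])
  finally show ?thesis .
qed

lemma sum_off_diagonal_swap:
  fixes f :: "nat \<Rightarrow> nat \<Rightarrow> 'a::comm_monoid_add"
  shows "(\<Sum>i=1..N. \<Sum>j\<in>{1..N} - {i}. f i j) = (\<Sum>i=1..N. \<Sum>j\<in>{1..N} - {i}. f j i)"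
proof -
  have "(\<Sum>i=1..N. \<Sum>j\<in>{1..N} - {i}. f i j) = (\<Sum>i=1..N. \<Sum>j | j \<in> {1..N} \<and> i \<noteq> j. f i j)"
    by (intro sum.cong refl) auto
  also have "\<dots> = (\<Sum>j=1..N. \<Sum>i | i \<in> {1..N} \<and> i \<noteq> j. f i j)"
    by (rule sum.swap_restrict) auto
  also have "\<dots> = (\<Sum>j=1..N. \<Sum>i\<in>{1..N} - {j}. f i j)"
    by (intro sum.cong refl) auto
  finally show ?thesis .
qed

text \<open>
  The first order part of the operator is averaged with its copy in which \<open>i\<close> and \<open>j\<close> are
  exchanged. This turns its factor \<open>2 * \<kappa>\<close> into \<open>\<kappa>\<close> and produces the differences treated by
  \<open>pair_interaction\<close>.
\<close>

lemma H_op_symmetric: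
  assumes C: "perm_invariant N n C" and x: "inj_on x {1..N}"
  shows "H_op N \<kappa> (\<lambda>x. \<Sum>v\<in>comps N n. C v * mpow N v x) x
    = (\<Sum>v\<in>comps N n. (diag_coeff N \<kappa> v * C v + \<kappa> * raise_sum N C v) * mpow N v x)"
proof -
  define P where "P = (\<lambda>x. \<Sum>v\<in>comps N n. C v * mpow N v x)"
  define G where "G i = (\<Sum>v\<in>comps N n. C v * real (v i) * mpow N v x)" for i
  define M where "M i j = (\<Sum>v\<in>comps N n. C v * real (max (v i) (v j)) * mpow N v x)" for i j
  define R where "R i j = (\<Sum>v\<in>comps N n. \<Sum>t\<in>shifts i j v.
            (real (v i) - real (v j) + 2 * real t) * (C (shift i j t v) * mpow N v x))" for i j
  have first: "(\<Sum>i=1..N. (x i)\<^sup>2 * partial i (partial i P) x)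
      = (\<Sum>v\<in>comps N n. (\<Sum>i=1..N. real (v i) * (real (v i) - 1)) * C v * mpow N v x)"
  proof -
    have "(\<Sum>i=1..N. (x i)\<^sup>2 * partial i (partial i P) x)
       = (\<Sum>i=1..N. \<Sum>v\<in>comps N n. C v * (real (v i) * (real (v i) - 1)) * mpow N v x)"
      unfolding P_def by (intro sum.cong refl euler_partial(2)) auto
    also have "\<dots> = (\<Sum>v\<in>comps N n. \<Sum>i=1..N. C v * (real (v i) * (real (v i) - 1)) * mpow N v x)"
      by (rule sum.swap)
    finally show ?thesis by (simp add: sum_distrib_left sum_distrib_right mult_ac)
  qed
  have "(x i)\<^sup>2 / (x i - x j) * partial i P x = x i * G i / (x i - x j)" if "i \<in> {1..N}" for i j
    using euler_partial(1)[OF that, of x C "comps N n"]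
    by (simp add: P_def G_def power2_eq_square mult.assoc)
  then have "(\<Sum>i=1..N. \<Sum>j\<in>{1..N} - {i}. (x i)\<^sup>2 / (x i - x j) * partial i P x)
     = (\<Sum>i=1..N. \<Sum>j\<in>{1..N} - {i}. x i * G i / (x i - x j))" (is "?S = ?S1")
    by (intro sum.cong refl)
  then have "2 * ?S = ?S1 + (\<Sum>i=1..N. \<Sum>j\<in>{1..N} - {i}. x j * G j / (x j - x i))"
    using sum_off_diagonal_swap[of "\<lambda>i j. x i * G i / (x i - x j)" N] by simp
  also have "\<dots> = (\<Sum>i=1..N. \<Sum>j\<in>{1..N} - {i}. x i * G i / (x i - x j) + x j * G j / (x j - x i))"
    by (simp only: sum.distrib)
  also have "\<dots> = (\<Sum>i=1..N. \<Sum>j\<in>{1..N} - {i}. M i j + R i j)"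
  proof (intro sum.cong refl)
    fix i j assume "i \<in> {1..N}" "j \<in> {1..N} - {i}"
    then have ij: "i \<in> {1..N}" "j \<in> {1..N}" "i \<noteq> j" by auto
    then have ne: "x i - x j \<noteq> 0" using inj_onD[OF x, of i j] by fastforce
    have "x j * G j / (x j - x i) = - (x j * G j / (x i - x j))"
      using minus_divide_right[of "x j * G j" "x i - x j"] by simp
    then have "x i * G i / (x i - x j) + x j * G j / (x j - x i) = (x i * G i - x j * G j) / (x i - x j)"
      by (simp add: diff_divide_distrib)
    also have "\<dots> = M i j + R i j"
      unfolding G_def M_def R_def pair_interaction[OF ij C] using ne by simp
    finally show "x i * G i / (x i - x j) + x j * G j / (x j - x i) = M i j + R i j" .
  qed
  also have "\<dots> = (\<Sum>v\<in>comps N n. (\<Sum>i=1..N. \<Sum>j\<in>{1..N} - {i}. real (max (v i) (v j))) * C v * mpow N v x)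
     + (\<Sum>v\<in>comps N n. raise_sum N C v * mpow N v x)"
  proof -
    have sw: "(\<Sum>i=1..N. \<Sum>j\<in>{1..N} - {i}. \<Sum>v\<in>comps N n. f i j v)
        = (\<Sum>v\<in>comps N n. \<Sum>i=1..N. \<Sum>j\<in>{1..N} - {i}. f i j v)" for f :: "nat \<Rightarrow> nat \<Rightarrow> (nat \<Rightarrow> nat) \<Rightarrow> real"
    proof -
      have "(\<Sum>i=1..N. \<Sum>j\<in>{1..N} - {i}. \<Sum>v\<in>comps N n. f i j v)
          = (\<Sum>i=1..N. \<Sum>v\<in>comps N n. \<Sum>j\<in>{1..N} - {i}. f i j v)"
        by (rule sum.cong[OF refl]) (rule sum.swap)
      also have "\<dots> = (\<Sum>v\<in>comps N n. \<Sum>i=1..N. \<Sum>j\<in>{1..N} - {i}. f i j v)"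
        by (rule sum.swap)
      finally show ?thesis .
    qed
    show ?thesis
      unfolding sum.distrib M_def R_def sw raise_sum_def
      by (simp add: sum_distrib_left sum_distrib_right mult_ac)
  qed
  finally have S: "2 * ?S = \<dots>" .
  have "H_op N \<kappa> P x = (\<Sum>i=1..N. (x i)\<^sup>2 * partial i (partial i P) x) + \<kappa> * (2 * ?S)"
    by (simp add: H_op_def)
  also have "\<dots> = (\<Sum>v\<in>comps N n. (diag_coeff N \<kappa> v * C v + \<kappa> * raise_sum N C v) * mpow N v x)"
    unfolding S first distrib_left sum_distrib_left[where A = "comps N n"] sum.distrib[symmetric]
    by (intro sum.cong refl) (simp add: diag_coeff_def algebra_simps)
  finally show ?thesis by (simp add: P_def)
qed

section \<open>Linear independence of monomials\<close>

lemma sum_digits_less: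
  fixes v :: "nat \<Rightarrow> nat"
  assumes "\<And>i. v i < B"
  shows "(\<Sum>i=1..N. v i * B ^ i) < B ^ Suc N"
proof (induction N)
  case 0
  show ?case using assms[of 0] by simp
next
  case (Suc N)
  have "(\<Sum>i=1..Suc N. v i * B ^ i) < B ^ Suc N + v (Suc N) * B ^ Suc N" using Suc by simp
  also have "\<dots> = Suc (v (Suc N)) * B ^ Suc N" by simp
  also have "\<dots> \<le> B * B ^ Suc N" using assms[of "Suc N"] by (intro mult_right_mono) auto
  finally show ?case by simp
qed

lemma sum_digits_inj:
  fixes v w :: "nat \<Rightarrow> nat"
  assumes "\<And>i. v i < B" "\<And>i. w i < B"
  shows "(\<Sum>i=1..N. v i * B ^ i) = (\<Sum>i=1..N. w i * B ^ i) \<Longrightarrow> i \<in> {1..N} \<Longrightarrow> v i = w i"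
proof (induction N)
  case (Suc N)
  have B: "B ^ Suc N > 0" using assms(1)[of 0] by simp
  have dm: "(\<Sum>i=1..Suc N. u i * B ^ i) div B ^ Suc N = u (Suc N)"
    "(\<Sum>i=1..Suc N. u i * B ^ i) mod B ^ Suc N = (\<Sum>i=1..N. u i * B ^ i)" if "\<And>i. u i < B" for u
    using sum_digits_less[of u B N, OF that] B by simp_all
  have "v (Suc N) = w (Suc N)" using dm(1)[of v] dm(1)[of w] assms Suc.prems(1) by metis
  moreover have "(\<Sum>i=1..N. v i * B ^ i) = (\<Sum>i=1..N. w i * B ^ i)"
    using dm(2)[of v] dm(2)[of w] assms Suc.prems(1) by metis
  ultimately show ?case using Suc by (cases "i = Suc N") auto
qed auto

text \<open>
  Substituting \<open>x\<^sub>i = t ^ (B ^ i)\<close> turns the monomials into powers of \<open>t\<close> with distinct exponents, by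
  uniqueness of the expansion in base \<open>B\<close>, and a polynomial in \<open>t\<close> with infinitely many zeros
  vanishes. For \<open>t > 1\<close> and \<open>B \<ge> 2\<close> the coordinates are pairwise distinct.
\<close>

lemma mpow_independent:
  assumes zero: "\<And>x. inj_on x {1..N} \<Longrightarrow> (\<Sum>v\<in>comps N n. a v * mpow N v x) = 0"
    and u: "u \<in> comps N n"
  shows "a u = 0"
proof -
  \<comment> \<open>Digits are at most \<open>n\<close>; the base \<open>n + 1\<close> would be \<open>1\<close> for \<open>n = 0\<close> and give equal coordinates.\<close>
  define B where "B = n + 2"
  define code where "code v = (\<Sum>i=1..N. v i * B ^ i)" for v
  have dig: "v i < B" if "v \<in> comps N n" for v i
    using comps_le[OF that, of i] by (simp add: B_def)
  have inj: "inj_on code (comps N n)"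
  proof (rule inj_onI)
    fix v w assume vw: "v \<in> comps N n" "w \<in> comps N n" "code v = code w"
    show "v = w"
    proof
      fix i show "v i = w i"
      proof (cases "i \<in> {1..N}")
        case True
        then show ?thesis using sum_digits_inj[of v B w N i] dig vw by (simp add: code_def)
      qed (use vw in \<open>auto simp: comps_def\<close>)
    qed
  qed
  define D where "D = Max (code ` comps N n)"
  \<comment> \<open>As \<open>code\<close> is injective, each \<open>c e\<close> is a single coefficient or \<open>0\<close>.\<close>
  define c where "c e = (\<Sum>v | v \<in> comps N n \<and> code v = e. a v)" for e
  have poly: "(\<Sum>e\<le>D. c e * t ^ e) = 0" if t: "t > 1" for t :: real
  proof -
    have "inj_on (\<lambda>i. t ^ (B ^ i)) {1..N}"
      using t by (auto simp: inj_on_def B_def)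
    from zero[OF this] have "0 = (\<Sum>v\<in>comps N n. a v * t ^ code v)"
      by (simp add: mpow_def code_def power_sum mult.commute flip: power_mult)
    also have "\<dots> = (\<Sum>e\<le>D. \<Sum>v | v \<in> comps N n \<and> code v = e. a v * t ^ code v)"
      by (rule sum.group[symmetric]) (auto simp: D_def)
    also have "\<dots> = (\<Sum>e\<le>D. c e * t ^ e)"
      by (simp add: c_def sum_distrib_right)
    finally show ?thesis by simp
  qed
  have "infinite {t :: real. (\<Sum>e\<le>D. c e * t ^ e) = 0}"
    using poly infinite_super[of "{1<..}" "{t :: real. (\<Sum>e\<le>D. c e * t ^ e) = 0}"] infinite_Ioi[of "1::real"] by auto
  then have "c (code u) = 0"
    using u polyfun_finite_roots[of c D] by (auto simp: D_def)
  moreover have "{v \<in> comps N n. code v = code u} = {u}"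
    using inj u by (auto simp: inj_on_def)
  ultimately show ?thesis by (simp add: c_def)
qed

section \<open>The recursion for the coefficients\<close>

definition raised :: "nat \<Rightarrow> (nat \<Rightarrow> nat) \<Rightarrow> (nat \<Rightarrow> nat) set" where
  "raised N v = {shift i j t v | i j t. i \<in> {1..N} \<and> j \<in> {1..N} \<and> i \<noteq> j \<and> t \<in> shifts i j v}"

lemma raise_sum_cong [fundef_cong]:
  assumes "N = N'" "v = v'" "\<And>u. u \<in> raised N' v' \<Longrightarrow> C u = C' u"
  shows "raise_sum N C v = raise_sum N' C' v'"
proof -
  have "C (shift i j t v') = C' (shift i j t v')"
    if "i \<in> {1..N'}" "j \<in> {1..N'} - {i}" "t \<in> shifts i j v'" for i j t
    using that by (intro assms(3)) (auto simp: raised_def)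
  then show ?thesis
    unfolding raise_sum_def assms(1,2) by (intro sum.cong refl) simp
qed

lemma raised_comps: "u \<in> raised N v \<Longrightarrow> v \<in> comps N n \<Longrightarrow> u \<in> comps N n"
  by (auto simp: raised_def shifts_def intro!: shift_comps)

lemma raised_sq_norm_less: "u \<in> raised N v \<Longrightarrow> sq_norm N v < sq_norm N u"
  by (auto simp: raised_def intro!: sq_norm_shift_less)

lemma raised_measure_less:
  assumes "u \<in> raised N v" "v \<in> comps N n"
  shows "n\<^sup>2 - sq_norm N u < n\<^sup>2 - sq_norm N v"
  using raised_sq_norm_less[OF assms(1)] sq_norm_le[OF raised_comps[OF assms]] by linarith

text \<open>
  The eigenvalue equation solved for \<open>C v\<close>. The recursion ends because every step enlarges the
  norm of \<open>v\<close>, which is bounded on vectors of a given weight.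
\<close>

function jack_coeff :: "nat \<Rightarrow> real \<Rightarrow> (nat \<Rightarrow> nat) \<Rightarrow> (nat \<Rightarrow> nat) \<Rightarrow> real" where
  "jack_coeff N \<kappa> l v =
     (if \<not> majorized N v l then 0
      else if v \<in> orbit_S N l then 1
      else \<kappa> * raise_sum N (\<lambda>u. jack_coeff N \<kappa> l u) v / (diag_coeff N \<kappa> l - diag_coeff N \<kappa> v))"
  by pat_completeness auto
termination
proof (relation "Wellfounded.measure (\<lambda>(N, \<kappa>, l, v). (weight N l)\<^sup>2 - sq_norm N v)")
  fix N \<kappa> l v u
  assume "\<not> \<not> majorized N v l" "u \<in> raised N v"
  then show "((N, \<kappa>, l, u), (N, \<kappa>, l, v)) \<in> Wellfounded.measure (\<lambda>(N, \<kappa>, l, v). (weight N l)\<^sup>2 - sq_norm N v)"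
    using raised_measure_less by (auto simp: majorized_def)
qed auto

declare jack_coeff.simps [simp del]

lemma comps_raise_induct [consumes 1, case_names raise]:
  assumes "v \<in> comps N n"
    and "\<And>v. v \<in> comps N n \<Longrightarrow> (\<And>u. u \<in> raised N v \<Longrightarrow> Q u) \<Longrightarrow> Q v"
  shows "Q v"
  using assms(1)
proof (induction v rule: measure_induct_rule[of "\<lambda>v. n\<^sup>2 - sq_norm N v"])
  case (less v)
  then show ?case using assms(2) raised_measure_less raised_comps by blast
qed

lemma majorized_refl: "l \<in> partitions N \<Longrightarrow> majorized N l l"
  by (simp add: majorized_iff_dominated dominated_def)

lemma majorized_orbit: "l \<in> partitions N \<Longrightarrow> v \<in> orbit_S N l \<Longrightarrow> majorized N v l"
  using majorized_orbit_iff majorized_refl by blast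

lemma jack_coeff_not_majorized: "\<not> majorized N v l \<Longrightarrow> jack_coeff N \<kappa> l v = 0"
  by (simp add: jack_coeff.simps)

lemma jack_coeff_orbit: "l \<in> partitions N \<Longrightarrow> v \<in> orbit_S N l \<Longrightarrow> jack_coeff N \<kappa> l v = 1"
  by (simp add: jack_coeff.simps majorized_orbit)

lemma raise_sum_permute:
  assumes p: "p permutes {1..N}" and C: "\<And>u. u \<in> raised N v \<Longrightarrow> C (u \<circ> p) = C u"
  shows "raise_sum N C (v \<circ> p) = raise_sum N C v"
proof -
  have peq: "p a = p b \<longleftrightarrow> a = b" for a b using permutes_inj[OF p] by (auto dest: injD)
  have sh: "shift i j t (v \<circ> p) = shift (p i) (p j) t v \<circ> p" for i j t
    by (auto simp: shift_def fun_eq_iff peq)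
  have "raise_sum N C (v \<circ> p) = (\<Sum>i=1..N. \<Sum>j\<in>{1..N} - {i}. \<Sum>t\<in>shifts (p i) (p j) v.
      (real (v (p i)) - real (v (p j)) + 2 * real t) * C (shift (p i) (p j) t v))"
    unfolding raise_sum_def
  proof (intro sum.cong refl)
    fix i j assume ij: "i \<in> {1..N}" "j \<in> {1..N} - {i}"
    show "shifts i j (v \<circ> p) = shifts (p i) (p j) v" by (simp add: shifts_def)
    fix t assume t: "t \<in> shifts (p i) (p j) v"
    have "p i \<in> {1..N}" "p j \<in> {1..N}" "p i \<noteq> p j"
      using ij permutes_in_image[OF p] peq by auto
    with t have "shift (p i) (p j) t v \<in> raised N v"
      unfolding raised_def by blast
    then show "(real ((v \<circ> p) i) - real ((v \<circ> p) j) + 2 * real t) * C (shift i j t (v \<circ> p))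
       = (real (v (p i)) - real (v (p j)) + 2 * real t) * C (shift (p i) (p j) t v)"
      by (simp add: sh C)
  qed
  also have "\<dots> = raise_sum N C v"
    unfolding raise_sum_def by (rule sum_off_diagonal_permute[OF p])
  finally show ?thesis .
qed

lemma jack_coeff_permute:
  assumes p: "p permutes {1..N}" and v: "v \<in> comps N n"
  shows "jack_coeff N \<kappa> l (v \<circ> p) = jack_coeff N \<kappa> l v"
  using v
proof (induction v rule: comps_raise_induct)
  case (raise v)
  have "majorized N (v \<circ> p) l \<longleftrightarrow> majorized N v l"
    by (rule majorized_orbit_iff) (use p in \<open>auto simp: orbit_S_def\<close>)
  then show ?case
    unfolding jack_coeff.simps[of N \<kappa> l v] jack_coeff.simps[of N \<kappa> l "v \<circ> p"]
    by (simp only: orbit_S_permute_iff[OF p] diag_coeff_permute[OF p]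
        raise_sum_permute[OF p, of v "jack_coeff N \<kappa> l", OF raise.IH])
qed

text \<open>
  \<open>v\<close> is a convex combination of \<open>u\<close> and its mirror image, so each sum of entries of \<open>v\<close> is at most
  the sum of \<open>u\<close> over an index set of the same size. Consequently the recursion also holds
  at vectors that are not majorized, where all terms vanish.
\<close>

lemma majorized_if_raised_majorized:
  assumes u: "u \<in> raised N v" and M: "majorized N u l" and v: "v \<in> comps N n"
  shows "majorized N v l"
proof -
  obtain i j t where ij: "i \<in> {1..N}" "j \<in> {1..N}" "i \<noteq> j" and t: "t \<in> shifts i j v"
    and u: "u = shift i j t v" using u by (auto simp: raised_def)
  have "u \<in> comps N n" using ij t v by (auto simp: u shifts_def intro: shift_comps)
  then have n: "n = weight N l" using M by (auto simp: majorized_def comps_def)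
  have ui: "u i = v i + t" "u j = v j - t" and uk: "\<And>k. k \<noteq> i \<Longrightarrow> k \<noteq> j \<Longrightarrow> u k = v k"
    using ij by (auto simp: u shift_def)
  have t': "t \<le> v j" "v j < v i + t" using t by (auto simp: shifts_def)
  have "sum v A \<le> sum l {1..card A}" if A: "A \<subseteq> {1..N}" for A
  proof -
    have fin: "finite A" using A finite_subset by blast
    have cong: "sum u B = sum v B" if "i \<notin> B" "j \<notin> B" for B
      using that uk by (intro sum.cong refl) metis
    have Mu: "sum u B \<le> sum l {1..card B}" if "B \<subseteq> {1..N}" for B
      using M that by (auto simp: majorized_def)
    consider "i \<in> A" | "i \<notin> A" "j \<notin> A" | "i \<notin> A" "j \<in> A" by blast
    then show ?thesis
    proof cases
      case 1
      have "sum v A \<le> sum u A"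
      proof (cases "j \<in> A")
        case True
        have "sum f A = f i + (f j + sum f (A - {i} - {j}))" for f :: "nat \<Rightarrow> nat"
          using 1 True ij fin sum.remove[of A i f] sum.remove[of "A - {i}" j f] by simp
        then show ?thesis using cong[of "A - {i} - {j}"] ui t' by simp
      next
        case False
        have "sum f A = f i + sum f (A - {i})" for f :: "nat \<Rightarrow> nat"
          using 1 fin by (rule sum.remove[rotated])
        then show ?thesis using cong[of "A - {i}"] ui False by simp
      qed
      then show ?thesis using Mu[OF A] by linarith
    next
      case 2
      then show ?thesis using cong Mu[OF A] by simp
    next
      case 3
      define B where "B = insert i (A - {j})"
      have "card B = card A"
        using 3 fin card.remove[of A j] by (simp add: B_def)
      moreover have "sum v A \<le> sum u B"
      proof -
        have "sum v A = v j + sum v (A - {j})" using 3(2) fin by (rule sum.remove[rotated])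
        also have "\<dots> \<le> u i + sum u (A - {j})" using cong[of "A - {j}"] 3 ui t' by simp
        also have "\<dots> = sum u B" using 3 fin by (simp add: B_def)
        finally show ?thesis .
      qed
      moreover have "B \<subseteq> {1..N}" using A ij by (auto simp: B_def)
      ultimately show ?thesis using Mu[of B] by simp
    qed
  qed
  then show ?thesis using v n by (simp add: majorized_def)
qed

lemma orbit_diag_coeff: "v \<in> orbit_S N l \<Longrightarrow> diag_coeff N \<kappa> v = diag_coeff N \<kappa> l"
  by (auto simp: orbit_S_def diag_coeff_permute)

lemma orbit_sq_norm: "v \<in> orbit_S N l \<Longrightarrow> sq_norm N v = sq_norm N l"
  by (auto simp: orbit_S_def sq_norm_permute)

lemma diag_coeff_less:
  assumes "majorized N v l" "l \<in> partitions N" "v \<notin> orbit_S N l" "\<kappa> \<ge> 0"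
  shows "diag_coeff N \<kappa> v < diag_coeff N \<kappa> l"
proof -
  have "real (sq_norm N v) < real (sq_norm N l)"
    using majorized_sq_norm_less[OF assms(1-3)] by simp
  then show ?thesis using sq_norm_diff_le_diag_diff[OF assms(1,2,4)] by linarith
qed

lemma raise_sum_zero: "(\<And>u. u \<in> raised N v \<Longrightarrow> C u = 0) \<Longrightarrow> raise_sum N C v = 0"
  using raise_sum_cong[of N N v v C "\<lambda>_. 0"] by (simp add: raise_sum_def)

text \<open>
  The definition guarantees the equation only off the orbit of \<open>l\<close> and for majorized vectors. On the
  orbit the diagonal terms agree, and the raised vectors are too long to be majorized.
\<close>

lemma jack_coeff_recursion:
  assumes l: "l \<in> partitions N" and \<kappa>: "\<kappa> \<ge> 0" and v: "v \<in> comps N n"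
  shows "diag_coeff N \<kappa> v * jack_coeff N \<kappa> l v + \<kappa> * raise_sum N (jack_coeff N \<kappa> l) v
     = diag_coeff N \<kappa> l * jack_coeff N \<kappa> l v"
proof -
  consider "\<not> majorized N v l" | "v \<in> orbit_S N l" | "majorized N v l" "v \<notin> orbit_S N l" by blast
  then show ?thesis
  proof cases
    case 1
    then have "raise_sum N (jack_coeff N \<kappa> l) v = 0"
      using majorized_if_raised_majorized[OF _ _ v] jack_coeff_not_majorized
      by (intro raise_sum_zero) blast
    then show ?thesis using 1 by (simp add: jack_coeff_not_majorized)
  next
    case 2
    have "raise_sum N (jack_coeff N \<kappa> l) v = 0"
    proof (intro raise_sum_zero jack_coeff_not_majorized notI)
      fix u assume "u \<in> raised N v" "majorized N u l"
      then show False
        using raised_sq_norm_less[of u N v] majorized_sq_norm_le[of N u l] orbit_sq_norm[OF 2] by simp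
    qed
    then show ?thesis by (simp add: orbit_diag_coeff[OF 2])
  next
    case 3
    then have "jack_coeff N \<kappa> l v
       = \<kappa> * raise_sum N (jack_coeff N \<kappa> l) v / (diag_coeff N \<kappa> l - diag_coeff N \<kappa> v)"
      by (subst jack_coeff.simps) simp
    then show ?thesis using diag_coeff_less[OF 3(1) l 3(2) \<kappa>] by (simp add: field_simps)
  qed
qed

lemma jack_coeff_unique:
  assumes l: "l \<in> partitions N" and \<kappa>: "\<kappa> \<ge> 0"
    and rec: "\<And>v. v \<in> comps N n \<Longrightarrow>
      diag_coeff N \<kappa> v * C v + \<kappa> * raise_sum N C v = diag_coeff N \<kappa> l * C v"
    and zero: "\<And>v. v \<in> comps N n \<Longrightarrow> \<not> majorized N v l \<Longrightarrow> C v = 0"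
    and one: "\<And>v. v \<in> orbit_S N l \<Longrightarrow> C v = 1"
    and v: "v \<in> comps N n"
  shows "C v = jack_coeff N \<kappa> l v"
  using v
proof (induction v rule: comps_raise_induct)
  case (raise v)
  have "raise_sum N C v = raise_sum N (jack_coeff N \<kappa> l) v"
    using raise.IH by (rule raise_sum_cong[OF refl refl])
  then have eq: "(diag_coeff N \<kappa> l - diag_coeff N \<kappa> v) * C v
      = (diag_coeff N \<kappa> l - diag_coeff N \<kappa> v) * jack_coeff N \<kappa> l v"
    using rec[OF raise.hyps] jack_coeff_recursion[OF l \<kappa> raise.hyps] by (simp add: algebra_simps)
  show ?case
  proof (cases "majorized N v l \<and> v \<notin> orbit_S N l")
    case True
    then show ?thesis using eq diag_coeff_less[OF _ l _ \<kappa>, of v] by simp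
  next
    case False
    then show ?thesis
      using zero[OF raise.hyps] one jack_coeff_not_majorized jack_coeff_orbit[OF l] by metis
  qed
qed

section \<open>Existence and uniqueness of Jack polynomials\<close>

text \<open>Each vector lies in the orbit of exactly one partition.\<close>

lemma sum_monomial_sym:
  "(\<Sum>m\<in>partitions N \<inter> comps N n. c m * monomial_sym N m x)
    = (\<Sum>v\<in>comps N n. c (sorted_comp N v) * mpow N v x)"
proof -
  have orb: "{v \<in> comps N n. sorted_comp N v = m} = orbit_S N m" if "m \<in> partitions N \<inter> comps N n" for m
    using that sorted_comp_eq_iff comps_orbit by blast
  have img: "sorted_comp N v \<in> partitions N \<inter> comps N n" if "v \<in> comps N n" for v
    using that sorted_comp comps_orbit by blast
  have "(\<Sum>v\<in>comps N n. c (sorted_comp N v) * mpow N v x)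
     = (\<Sum>m\<in>partitions N \<inter> comps N n. \<Sum>v | v \<in> comps N n \<and> sorted_comp N v = m. c (sorted_comp N v) * mpow N v x)"
    by (rule sum.group[symmetric]) (use img in auto)
  also have "\<dots> = (\<Sum>m\<in>partitions N \<inter> comps N n. c m * monomial_sym N m x)"
    unfolding monomial_sym_def sum_distrib_left
    by (intro sum.cong) (auto simp: mpow_def orb simp flip: orb)
  finally show ?thesis by simp
qed

lemma monomial_expansion:
  assumes l: "l \<in> partitions N"
  shows "monomial_sym N l x + (\<Sum>m\<in>{m \<in> partitions N. dominated N m l \<and> m \<noteq> l}. c m * monomial_sym N m x)
    = (\<Sum>m\<in>partitions N \<inter> comps N (weight N l).
        (if m = l then 1 else if dominated N m l then c m else 0) * monomial_sym N m x)"
    (is "_ + (\<Sum>m\<in>?D. _) = (\<Sum>m\<in>?K. ?c m * _)")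
proof -
  have lK: "l \<in> ?K" using l partition_in_comps by blast
  have DK: "?D \<subseteq> ?K - {l}"
    using partition_in_comps by (fastforce simp: dominated_def)
  have "(\<Sum>m\<in>?K. ?c m * monomial_sym N m x)
      = monomial_sym N l x + (\<Sum>m\<in>?K - {l}. ?c m * monomial_sym N m x)"
    using lK by (subst sum.remove[of _ l]) auto
  also have "(\<Sum>m\<in>?K - {l}. ?c m * monomial_sym N m x) = (\<Sum>m\<in>?D. c m * monomial_sym N m x)"
    using DK by (intro sum.mono_neutral_cong_right) auto
  finally show ?thesis by simp
qed

definition jack_sum :: "nat \<Rightarrow> real \<Rightarrow> (nat \<Rightarrow> nat) \<Rightarrow> (nat \<Rightarrow> real) \<Rightarrow> real" where
  "jack_sum N \<kappa> l x = (\<Sum>v\<in>comps N (weight N l). jack_coeff N \<kappa> l v * mpow N v x)"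

lemma is_jack_jack_sum:
  assumes l: "l \<in> partitions N" and \<alpha>: "\<alpha> > 0"
  shows "is_jack N \<alpha> l (jack_sum N (1 / \<alpha>) l)"
proof -
  define \<kappa> where "\<kappa> = 1 / \<alpha>"
  define K where "K = comps N (weight N l)"
  have \<kappa>: "\<kappa> \<ge> 0" using \<alpha> by (simp add: \<kappa>_def)
  have inv: "perm_invariant N (weight N l) (jack_coeff N \<kappa> l)"
    using jack_coeff_permute by (auto simp: perm_invariant_def)
  have sym: "jack_sum N \<kappa> l (x \<circ> p) = jack_sum N \<kappa> l x" if p: "p permutes {1..N}" for p x
  proof -
    have "jack_sum N \<kappa> l (x \<circ> p) = (\<Sum>v\<in>K. jack_coeff N \<kappa> l (v \<circ> p) * mpow N (v \<circ> p) (x \<circ> p))"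
      unfolding jack_sum_def K_def
      by (rule sum.reindex_bij_betw[symmetric]) (rule bij_betw_comps_permute[OF p])
    also have "\<dots> = jack_sum N \<kappa> l x"
      unfolding jack_sum_def K_def
      by (intro sum.cong refl) (simp add: jack_coeff_permute[OF p] mpow_permute[OF p])
    finally show ?thesis .
  qed
  have hom: "jack_sum N \<kappa> l (\<lambda>i. t * x i) = t ^ weight N l * jack_sum N \<kappa> l x" for t x
  proof -
    have "mpow N v (\<lambda>i. t * x i) = t ^ weight N l * mpow N v x" if "v \<in> K" for v
      using that by (simp add: mpow_def power_mult_distrib prod.distrib K_def comps_def weight_def flip: power_sum)
    then show ?thesis unfolding jack_sum_def sum_distrib_left
      by (intro sum.cong refl) (simp add: K_def)
  qed
  have exp: "jack_sum N \<kappa> l x = monomial_sym N l x +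
      (\<Sum>m\<in>{m \<in> partitions N. dominated N m l \<and> m \<noteq> l}. jack_coeff N \<kappa> l m * monomial_sym N m x)" for x
  proof -
    have "jack_coeff N \<kappa> l (sorted_comp N v) = jack_coeff N \<kappa> l v" if "v \<in> K" for v
    proof -
      have "sorted_comp N v \<in> orbit_S N v" using that sorted_comp_orbit by (simp add: K_def)
      then obtain p where "p permutes {1..N}" "sorted_comp N v = v \<circ> p" by (auto simp: orbit_S_def)
      then show ?thesis using jack_coeff_permute that by (simp add: K_def)
    qed
    then have "jack_sum N \<kappa> l x = (\<Sum>m\<in>partitions N \<inter> K. jack_coeff N \<kappa> l m * monomial_sym N m x)"
      unfolding K_def sum_monomial_sym by (simp add: jack_sum_def K_def)
    also have "\<dots> = (\<Sum>m\<in>partitions N \<inter> K.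
        (if m = l then 1 else if dominated N m l then jack_coeff N \<kappa> l m else 0) * monomial_sym N m x)"
      using jack_coeff_orbit[OF l orbit_S_refl] jack_coeff_not_majorized[of N _ l \<kappa>] majorized_iff_dominated[of _ N l]
      by (intro sum.cong refl) auto
    finally show ?thesis unfolding monomial_expansion[OF l] K_def .
  qed
  have eig: "H_op N \<kappa> (jack_sum N \<kappa> l) x = H_eigenvalue N \<kappa> l * jack_sum N \<kappa> l x"
    if "inj_on x {1..N}" for x
  proof -
    have "jack_sum N \<kappa> l = (\<lambda>x. \<Sum>v\<in>K. jack_coeff N \<kappa> l v * mpow N v x)"
      by (auto simp: jack_sum_def K_def)
    then have "H_op N \<kappa> (jack_sum N \<kappa> l) x = (\<Sum>v\<in>K. (diag_coeff N \<kappa> l * jack_coeff N \<kappa> l v) * mpow N v x)"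
      using H_op_symmetric[OF inv that, of \<kappa>] jack_coeff_recursion[OF l \<kappa>] by (simp add: K_def)
    then show ?thesis
      by (simp add: jack_sum_def K_def sum_distrib_left mult.assoc diag_coeff_partition[OF l])
  qed
  show ?thesis
    unfolding is_jack_def \<kappa>_def[symmetric] using sym hom exp eig by blast
qed

lemma is_jack_unique:
  assumes l: "l \<in> partitions N" and \<alpha>: "\<alpha> > 0" and P: "is_jack N \<alpha> l P"
  shows "P = jack_sum N (1 / \<alpha>) l"
proof -
  define \<kappa> where "\<kappa> = 1 / \<alpha>"
  define K where "K = comps N (weight N l)"
  have \<kappa>: "\<kappa> \<ge> 0" using \<alpha> by (simp add: \<kappa>_def)
  obtain c where c: "P = (\<lambda>x. monomial_sym N l x +
        (\<Sum>m\<in>{m \<in> partitions N. dominated N m l \<and> m \<noteq> l}. c m * monomial_sym N m x))"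
    using P by (auto simp: is_jack_def)
  \<comment> \<open>Extends the given coefficients to all partitions, then to all vectors by sorting.\<close>
  define c' where "c' m = (if m = l then 1 else if dominated N m l then c m else 0)" for m
  define C where "C v = c' (sorted_comp N v)" for v
  have PC: "P = (\<lambda>x. \<Sum>v\<in>K. C v * mpow N v x)"
    unfolding c monomial_expansion[OF l] C_def K_def sum_monomial_sym[symmetric] by (simp add: c'_def)
  have inv: "perm_invariant N (weight N l) C"
    unfolding perm_invariant_def C_def
  proof (intro ballI allI impI arg_cong[of _ _ c'])
    fix v p assume v: "v \<in> comps N (weight N l)" and p: "p permutes {1..N}"
    have "v \<in> orbit_S N (sorted_comp N v)" using sorted_comp_eq_iff v sorted_comp_partition by blast
    then show "sorted_comp N (v \<circ> p) = sorted_comp N v"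
      using sorted_comp_eq_iff[OF comps_permute[OF p v] sorted_comp_partition[OF v]]
      by (simp add: orbit_S_permute_iff[OF p])
  qed
  have rec: "diag_coeff N \<kappa> v * C v + \<kappa> * raise_sum N C v = diag_coeff N \<kappa> l * C v"
    if "v \<in> K" for v
  proof -
    have "(\<Sum>v\<in>K. (diag_coeff N \<kappa> v * C v + \<kappa> * raise_sum N C v - diag_coeff N \<kappa> l * C v) * mpow N v x) = 0"
      if x: "inj_on x {1..N}" for x
    proof -
      have "H_op N \<kappa> P x = diag_coeff N \<kappa> l * P x"
        using P x by (simp add: is_jack_def \<kappa>_def diag_coeff_partition[OF l])
      then show ?thesis
        using H_op_symmetric[OF inv x, of \<kappa>] unfolding PC
        by (simp add: K_def left_diff_distrib sum_subtractf sum_distrib_left mult.assoc)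
    qed
    from mpow_independent[OF this[unfolded K_def] that[unfolded K_def]] show ?thesis by simp
  qed
  have zero: "C v = 0" if v: "v \<in> K" and nM: "\<not> majorized N v l" for v
  proof -
    have "\<not> majorized N (sorted_comp N v) l"
      using majorized_orbit_iff[OF sorted_comp_orbit] v nM by (auto simp: K_def)
    then have "\<not> dominated N (sorted_comp N v) l"
      using majorized_iff_dominated sorted_comp_partition v by (auto simp: K_def)
    then show ?thesis by (auto simp: C_def c'_def dominated_def)
  qed
  have one: "C v = 1" if v: "v \<in> orbit_S N l" for v
  proof -
    have "v \<in> comps N (weight N l)" using comps_orbit[OF partition_in_comps[OF l] v] .
    then show ?thesis using sorted_comp_eq_iff[OF _ l] v by (simp add: C_def c'_def)
  qed
  have "C v = jack_coeff N \<kappa> l v" if "v \<in> K" for v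
    using jack_coeff_unique[OF l \<kappa>, of "weight N l" C] rec zero one that by (simp add: K_def)
  then show ?thesis
    unfolding PC by (auto simp: jack_sum_def K_def \<kappa>_def)
qed

lemma jack_eq_jack_sum:
  assumes "l \<in> partitions N" "\<alpha> > 0"
  shows "jack N \<alpha> l = jack_sum N (1 / \<alpha>) l"
  unfolding jack_def using is_jack_jack_sum[OF assms] is_jack_unique[OF assms] by (rule the_equality)

section \<open>Positivity and polynomial growth of the coefficients\<close>

lemma raise_sum_nonneg:
  assumes "\<And>u. u \<in> raised N v \<Longrightarrow> 0 \<le> C u"
  shows "0 \<le> raise_sum N C v"
  unfolding raise_sum_def
proof (intro sum_nonneg mult_nonneg_nonneg)
  fix i j t assume "i \<in> {1..N}" "j \<in> {1..N} - {i}" and t: "t \<in> shifts i j v"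
  then show "0 \<le> C (shift i j t v)" by (intro assms) (auto simp: raised_def)
  have "real (v j) \<le> real (v i) + real t" using t by (auto simp: shifts_def simp flip: of_nat_add)
  then show "0 \<le> real (v i) - real (v j) + 2 * real t" by linarith
qed

lemma jack_coeff_nonneg:
  assumes l: "l \<in> partitions N" and \<kappa>: "\<kappa> \<ge> 0" and v: "v \<in> comps N n"
  shows "0 \<le> jack_coeff N \<kappa> l v"
  using v
proof (induction v rule: comps_raise_induct)
  case (raise v)
  have "0 \<le> raise_sum N (jack_coeff N \<kappa> l) v" using raise.IH by (rule raise_sum_nonneg)
  then show ?case
    using \<kappa> diag_coeff_less[OF _ l _ \<kappa>, of v] by (subst jack_coeff.simps) auto
qed

text \<open>
  The discrete form of bounding \<open>b\<^sup>p * (a - b)\<close> by the integral of \<open>y\<^sup>p\<close> over \<open>[b, a]\<close>.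
\<close>

lemma power_Suc_diff_ge:
  fixes a b :: real
  assumes "0 \<le> b" "b \<le> a"
  shows "real (Suc p) * (a - b) * b ^ p \<le> a ^ Suc p - b ^ Suc p"
proof (induction p)
  case (Suc p)
  have "real (Suc (Suc p)) * (a - b) * b ^ Suc p
      = b * (real (Suc p) * (a - b) * b ^ p) + (a - b) * b ^ Suc p"
    by (simp add: algebra_simps)
  also have "\<dots> \<le> b * (a ^ Suc p - b ^ Suc p) + (a - b) * b ^ Suc p"
    using Suc assms(1) by (intro add_right_mono mult_left_mono)
  also have "\<dots> \<le> a * (a ^ Suc p - b ^ Suc p) + (a - b) * b ^ Suc p"
    using assms by (intro add_right_mono mult_right_mono) (auto intro: power_mono simp del: power_Suc)
  also have "\<dots> = a ^ Suc (Suc p) - b ^ Suc (Suc p)" by (simp add: algebra_simps)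
  finally show ?case .
qed auto

text \<open>
  The Riemann sum estimate. With \<open>s(t) = 2 * t * (d + t)\<close> the hypothesis bounds \<open>f t\<close> by the value of
  \<open>y\<^sup>p\<close> at \<open>y = E + 1 - s(t)\<close>, cut off at \<open>0\<close>, and \<open>d + 2 * t \<le> s(t) - s(t - 1)\<close> because \<open>t\<close> and
  \<open>d + t\<close> are both at least \<open>1\<close>. So the sum is at most the integral of \<open>y\<^sup>p\<close> over
  \<open>[0, E + 1]\<close>, whose discrete form telescopes in the powers \<open>p + 1\<close>. The sum starts just after
  \<open>t = max 0 (- d)\<close>, where \<open>s\<close> vanishes.
\<close>

lemma sum_shifts_le:
  fixes f :: "nat \<Rightarrow> real" and E :: real and i j :: nat and v :: "nat \<Rightarrow> nat"
  assumes p: "p \<ge> 1" and E: "E \<ge> 0"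
  defines "d \<equiv> real (v i) - real (v j)"
  assumes f: "\<And>t. t \<in> shifts i j v \<Longrightarrow> f t \<le> (max 0 (E + 1 - 2 * real t * (d + real t))) ^ p"
  shows "(\<Sum>t\<in>shifts i j v. (d + 2 * real t) * f t) \<le> (E + 1) ^ Suc p / real (Suc p)"
proof -
  define s where "s t = 2 * real t * (d + real t)" for t
  define F where "F t = max 0 (E + 1 - s t)" for t
  define a where "a = v j - v i"
  have T: "shifts i j v = {Suc a..v j}" by (auto simp: shifts_def a_def)
  have step: "(d + 2 * real (Suc t)) * f (Suc t)
      \<le> (F t ^ Suc p - F (Suc t) ^ Suc p) / real (Suc p)" if t: "t \<in> {a..<v j}" for t
  proof -
    have S: "Suc t \<in> shifts i j v" using t unfolding T by auto
    then have "v j + 1 \<le> v i + Suc t" by (auto simp: shifts_def)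
    then have dt: "d + real (Suc t) \<ge> 1" unfolding d_def by linarith
    have inc: "d + 2 * real (Suc t) \<le> s (Suc t) - s t"
      using dt by (simp add: s_def algebra_simps)
    have inc0: "0 \<le> d + 2 * real (Suc t)" using add_nonneg_nonneg[of "d + real (Suc t)" "real (Suc t)"] dt by simp
    have F0: "0 \<le> F (Suc t)" by (simp add: F_def)
    have "(d + 2 * real (Suc t)) * f (Suc t) \<le> (d + 2 * real (Suc t)) * F (Suc t) ^ p"
      using f[OF S] inc0 by (intro mult_left_mono) (auto simp: F_def s_def)
    also have "\<dots> \<le> (F t - F (Suc t)) * F (Suc t) ^ p"
    proof (cases "F (Suc t) = 0")
      case True
      then show ?thesis using p by (simp add: power_0_left)
    next
      case False
      then have "F (Suc t) = E + 1 - s (Suc t)" by (auto simp: F_def max_def split: if_splits)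
      moreover have "E + 1 - s t \<le> F t" by (simp add: F_def)
      ultimately have "d + 2 * real (Suc t) \<le> F t - F (Suc t)" using inc by linarith
      then show ?thesis using F0 by (intro mult_right_mono) auto
    qed
    also have "\<dots> \<le> (F t ^ Suc p - F (Suc t) ^ Suc p) / real (Suc p)"
    proof -
      have "F (Suc t) \<le> F t" using inc inc0 by (simp add: F_def)
      from power_Suc_diff_ge[OF F0 this, of p] show ?thesis
        by (simp add: pos_le_divide_eq mult_ac)
    qed
    finally show ?thesis .
  qed
  have av: "a \<le> v j" by (simp add: a_def)
  have "(\<Sum>t\<in>shifts i j v. (d + 2 * real t) * f t)
      = (\<Sum>t=a..<v j. (d + 2 * real (Suc t)) * f (Suc t))"
    unfolding T using sum.shift_bounds_Suc_ivl[of "\<lambda>t. (d + 2 * real t) * f t" a "v j"]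
    by (simp add: atLeastLessThanSuc_atLeastAtMost)
  also have "\<dots> \<le> (\<Sum>t=a..<v j. (F t ^ Suc p - F (Suc t) ^ Suc p) / real (Suc p))"
    by (intro sum_mono step)
  also have "\<dots> = (F a ^ Suc p - F (v j) ^ Suc p) / real (Suc p)"
    using sum_Suc_diff'[OF av, of "\<lambda>t. - (F t ^ Suc p)"] by (simp add: sum_divide_distrib[symmetric])
  also have "\<dots> \<le> F a ^ Suc p / real (Suc p)"
    by (intro divide_right_mono) (simp_all add: F_def)
  also have "s a = 0"
    by (cases "v i \<le> v j") (auto simp: s_def a_def d_def of_nat_diff)
  then have "F a = E + 1" using E by (simp add: F_def)
  finally show ?thesis .
qed

text \<open>
  Induction along the recursion with \<open>E = |l|\<^sup>2 - |v|\<^sup>2\<close>. By \<open>sum_shifts_le\<close> each of the at most \<open>N\<^sup>2\<close>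
  ordered pairs contributes at most \<open>(E + 1) ^ (p + 1) / (p + 1)\<close>. Division by the eigenvalue
  difference, which is at least \<open>E \<ge> (E + 1) / 2\<close>, leaves the factor
  \<open>2 * \<kappa> * N\<^sup>2 / (p + 1)\<close>, and the choice of \<open>p\<close> makes it at most \<open>1\<close>.
\<close>

lemma jack_coeff_le:
  assumes l: "l \<in> partitions N" and \<kappa>: "\<kappa> \<ge> 0"
    and p: "p \<ge> 1" "2 * \<kappa> * real N ^ 2 \<le> real (Suc p)"
    and v: "v \<in> comps N (weight N l)" and M: "majorized N v l"
  shows "jack_coeff N \<kappa> l v \<le> (real (sq_norm N l) - real (sq_norm N v) + 1) ^ p"
  using v M
proof (induction v rule: comps_raise_induct)
  case (raise v)
  define E where "E = real (sq_norm N l) - real (sq_norm N v)"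
  show ?case
  proof (cases "v \<in> orbit_S N l")
    case True
    then show ?thesis using orbit_sq_norm jack_coeff_orbit[OF l] by simp
  next
    case False
    have "sq_norm N v < sq_norm N l" using majorized_sq_norm_less[OF raise.prems l False] .
    then have E1: "E \<ge> 1" unfolding E_def by linarith
    define B where "B = (E + 1) ^ Suc p / real (Suc p)"
    have B0: "0 \<le> B" using E1 by (simp add: B_def)
    have inner: "(\<Sum>t\<in>shifts i j v. (real (v i) - real (v j) + 2 * real t) * jack_coeff N \<kappa> l (shift i j t v)) \<le> B"
      if ij: "i \<in> {1..N}" "j \<in> {1..N} - {i}" for i j
      unfolding B_def
    proof (rule sum_shifts_le[OF p(1)])
      show "0 \<le> E" using E1 by simp
      fix t assume t: "t \<in> shifts i j v"
      define u where "u = shift i j t v"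
      have u: "u \<in> raised N v" using t ij unfolding raised_def u_def by blast
      have "real (sq_norm N u) = real (sq_norm N v) + 2 * real t * (real (v i) - real (v j) + real t)"
        unfolding u_def using ij t by (intro sq_norm_shift) (auto simp: shifts_def)
      then have Eu: "E - 2 * real t * (real (v i) - real (v j) + real t)
          = real (sq_norm N l) - real (sq_norm N u)" by (simp add: E_def)
      show "jack_coeff N \<kappa> l (shift i j t v)
          \<le> (max 0 (E + 1 - 2 * real t * (real (v i) - real (v j) + real t))) ^ p"
      proof (cases "majorized N u l")
        case True
        have "jack_coeff N \<kappa> l u \<le> (real (sq_norm N l) - real (sq_norm N u) + 1) ^ p"
          using raise.IH[OF u True] .
        also have "\<dots> \<le> (max 0 (E + 1 - 2 * real t * (real (v i) - real (v j) + real t))) ^ p"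
          using majorized_sq_norm_le[OF True] Eu by (intro power_mono) auto
        finally show ?thesis by (simp add: u_def)
      next
        case False
        then show ?thesis by (simp add: jack_coeff_not_majorized u_def)
      qed
    qed
    have "raise_sum N (jack_coeff N \<kappa> l) v \<le> (\<Sum>i=1..N. \<Sum>j\<in>{1..N} - {i}. B)"
      unfolding raise_sum_def by (intro sum_mono inner)
    also have "\<dots> \<le> (\<Sum>i=1..N. real N * B)"
    proof (intro sum_mono)
      fix i assume "i \<in> {1..N}"
      have "card ({1..N} - {i}) \<le> N" using card_mono[of "{1..N}" "{1..N} - {i}"] by simp
      then show "(\<Sum>j\<in>{1..N} - {i}. B) \<le> real N * B"
        using B0 by (simp only: sum_constant) (intro mult_right_mono, auto)
    qed
    finally have R: "raise_sum N (jack_coeff N \<kappa> l) v \<le> real N ^ 2 * B"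
      by (simp add: power2_eq_square)
    have R0: "0 \<le> raise_sum N (jack_coeff N \<kappa> l) v"
      by (intro raise_sum_nonneg jack_coeff_nonneg[OF l \<kappa>]) (rule raised_comps[OF _ raise.hyps])
    have "jack_coeff N \<kappa> l v
       = \<kappa> * raise_sum N (jack_coeff N \<kappa> l) v / (diag_coeff N \<kappa> l - diag_coeff N \<kappa> v)"
      using raise.prems False by (subst jack_coeff.simps) simp
    also have "\<dots> \<le> \<kappa> * raise_sum N (jack_coeff N \<kappa> l) v / E"
      using sq_norm_diff_le_diag_diff[OF raise.prems l \<kappa>] E1 \<kappa> R0
      by (intro divide_left_mono mult_nonneg_nonneg mult_pos_pos) (auto simp: E_def)
    also have "\<dots> \<le> \<kappa> * (real N ^ 2 * B) / E"
      using R \<kappa> E1 by (intro divide_right_mono mult_left_mono) auto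
    also have "\<dots> = (\<kappa> * real N ^ 2 * (E + 1)) * (E + 1) ^ p / (E * real (Suc p))"
      by (simp add: B_def field_simps)
    also have "\<dots> \<le> (E * real (Suc p)) * (E + 1) ^ p / (E * real (Suc p))"
    proof (intro divide_right_mono mult_right_mono)
      have "\<kappa> * real N ^ 2 * (E + 1) \<le> \<kappa> * real N ^ 2 * (2 * E)"
        using E1 \<kappa> by (intro mult_left_mono) auto
      also have "\<dots> = E * (2 * \<kappa> * real N ^ 2)" by simp
      also have "\<dots> \<le> E * real (Suc p)" using p(2) E1 by (intro mult_left_mono) auto
      finally show "\<kappa> * real N ^ 2 * (E + 1) \<le> E * real (Suc p)" .
    qed (use E1 in auto)
    also have "\<dots> = (E + 1) ^ p" using E1 by simp
    finally show ?thesis by (simp add: E_def)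
  qed
qed

section \<open>Two-sided bound for Jack polynomials on the cone\<close>

text \<open>
  Multiplicative summation by parts. The surplus exponents of \<open>l\<close> are carried along at the last,
  hence smallest, variable; this strengthening makes the induction go through.
\<close>

lemma prod_power_le_of_partial_sums:
  fixes x :: "nat \<Rightarrow> real" and v l :: "nat \<Rightarrow> nat"
  assumes "\<And>i. i \<in> {1..n} \<Longrightarrow> 0 \<le> x i"
    and "\<And>i. 1 \<le> i \<Longrightarrow> i < n \<Longrightarrow> x (Suc i) \<le> x i"
    and "\<And>r. r \<le> n \<Longrightarrow> sum v {1..r} \<le> sum l {1..r}"
  shows "(\<Prod>i=1..n. x i ^ v i) * x n ^ (sum l {1..n} - sum v {1..n}) \<le> (\<Prod>i=1..n. x i ^ l i)"
  using assms
proof (induction n)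
  case (Suc n)
  define D where "D = sum l {1..n} - sum v {1..n}"
  have IH: "(\<Prod>i=1..n. x i ^ v i) * x n ^ D \<le> (\<Prod>i=1..n. x i ^ l i)"
    unfolding D_def using Suc by auto
  have x0: "0 \<le> x (Suc n)" using Suc.prems(1) by simp
  have V0: "0 \<le> (\<Prod>i=1..n. x i ^ v i)"
    using Suc.prems(1) by (intro prod_nonneg) auto
  have e: "v (Suc n) + (sum l {1..Suc n} - sum v {1..Suc n}) = l (Suc n) + D"
    using Suc.prems(3)[of n] Suc.prems(3)[of "Suc n"] by (simp add: D_def)
  have "(\<Prod>i=1..Suc n. x i ^ v i) * x (Suc n) ^ (sum l {1..Suc n} - sum v {1..Suc n})
     = (\<Prod>i=1..n. x i ^ v i) * x (Suc n) ^ (v (Suc n) + (sum l {1..Suc n} - sum v {1..Suc n}))"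
    unfolding power_add by simp
  also have "\<dots> = ((\<Prod>i=1..n. x i ^ v i) * x (Suc n) ^ D) * x (Suc n) ^ l (Suc n)"
    unfolding e power_add by simp
  also have "\<dots> \<le> ((\<Prod>i=1..n. x i ^ v i) * x n ^ D) * x (Suc n) ^ l (Suc n)"
  proof (cases "n = 0")
    case True
    then show ?thesis by (simp add: D_def)
  next
    case False
    then have "x (Suc n) ^ D \<le> x n ^ D" using Suc.prems(2)[of n] x0 by (intro power_mono) auto
    then show ?thesis using V0 x0 by (intro mult_right_mono mult_left_mono) auto
  qed
  also have "\<dots> \<le> (\<Prod>i=1..n. x i ^ l i) * x (Suc n) ^ l (Suc n)"
    using IH x0 by (intro mult_right_mono) auto
  finally show ?case by simp
qed auto

lemma mpow_nonneg: "x \<in> cone_B N \<Longrightarrow> 0 \<le> mpow N v x"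
  unfolding mpow_def cone_B_def by (intro prod_nonneg) auto

lemma mpow_majorized_le:
  assumes x: "x \<in> cone_B N" and M: "majorized N v l"
  shows "mpow N v x \<le> mpow N l x"
proof -
  have part: "sum v {1..r} \<le> sum l {1..r}" if "r \<le> N" for r
    using M that by (auto simp: majorized_def dest!: spec[of _ "{1..r}"])
  have eq: "sum l {1..N} - sum v {1..N} = 0"
    using M by (simp add: majorized_def comps_def weight_def)
  have "(\<Prod>i=1..N. x i ^ v i) * x N ^ (sum l {1..N} - sum v {1..N}) \<le> (\<Prod>i=1..N. x i ^ l i)"
    by (rule prod_power_le_of_partial_sums) (use x part in \<open>auto simp: cone_B_def\<close>)
  then show ?thesis unfolding eq by (simp add: mpow_def)
qed

lemma jack_sum_ge:
  assumes l: "l \<in> partitions N" and \<kappa>: "\<kappa> \<ge> 0" and x: "x \<in> cone_B N"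
  shows "mpow N l x \<le> jack_sum N \<kappa> l x"
proof -
  have "jack_coeff N \<kappa> l l * mpow N l x \<le> jack_sum N \<kappa> l x"
    unfolding jack_sum_def
    by (rule member_le_sum)
      (use partition_in_comps[OF l] jack_coeff_nonneg[OF l \<kappa>] mpow_nonneg[OF x] in auto)
  then show ?thesis by (simp add: jack_coeff_orbit[OF l orbit_S_refl])
qed

lemma jack_sum_le:
  assumes l: "l \<in> partitions N" and \<kappa>: "\<kappa> \<ge> 0" and x: "x \<in> cone_B N"
    and p: "p \<ge> 1" "2 * \<kappa> * real N ^ 2 \<le> real (Suc p)"
  shows "jack_sum N \<kappa> l x \<le> (real (weight N l) + 1) ^ (N + 2 * p) * mpow N l x"
proof -
  define n where "n = weight N l"
  have "jack_coeff N \<kappa> l v * mpow N v x \<le> (real n + 1) ^ (2 * p) * mpow N l x"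
    if v: "v \<in> comps N n" for v
  proof (cases "majorized N v l")
    case True
    have "jack_coeff N \<kappa> l v \<le> (real (sq_norm N l) - real (sq_norm N v) + 1) ^ p"
      using jack_coeff_le[OF l \<kappa> p _ True] v by (simp add: n_def)
    also have "\<dots> \<le> ((real n + 1)\<^sup>2) ^ p"
    proof (intro power_mono)
      have "real (sq_norm N l) \<le> (real n)\<^sup>2"
        using sq_norm_le[OF partition_in_comps[OF l]] by (simp add: n_def flip: of_nat_power)
      also have "\<dots> + 1 \<le> (real n + 1)\<^sup>2" by (simp add: power2_eq_square algebra_simps)
      finally show "real (sq_norm N l) - real (sq_norm N v) + 1 \<le> (real n + 1)\<^sup>2" by simp
      show "0 \<le> real (sq_norm N l) - real (sq_norm N v) + 1"
        using majorized_sq_norm_le[OF True] by simp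
    qed
    finally show ?thesis
      using mpow_majorized_le[OF x True] mpow_nonneg[OF x] by (intro mult_mono) (auto simp: power_mult)
  next
    case False
    then show ?thesis using mpow_nonneg[OF x] by (simp add: jack_coeff_not_majorized)
  qed
  then have "jack_sum N \<kappa> l x \<le> real (card (comps N n)) * ((real n + 1) ^ (2 * p) * mpow N l x)"
    unfolding jack_sum_def n_def by (rule sum_bounded_above)
  also have "\<dots> \<le> (real n + 1) ^ N * ((real n + 1) ^ (2 * p) * mpow N l x)"
  proof (rule mult_right_mono)
    have "real (card (comps N n)) \<le> real ((n + 1) ^ N)" using card_comps_le by (rule of_nat_mono)
    then show "real (card (comps N n)) \<le> (real n + 1) ^ N" by (simp add: add.commute)
  qed (use mpow_nonneg[OF x] in auto)
  finally show ?thesis by (simp add: n_def power_add mult.assoc)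
qed

section \<open>The limit\<close>

text \<open>
  At \<open>x i = 0\<close> the convention \<open>0\<^sup>0 = 1\<close> in \<open>rpow\<close> matches \<open>x i ^ 0 = 1\<close>.
\<close>

lemma prod_rpow_eq:
  assumes x: "x \<in> cone_B N" and k: "k > 0"
  shows "(\<Prod>i=1..N. rpow (x i) (real (l i) / k)) = mpow N l x powr (1 / k)"
proof -
  have "mpow N l x powr (1 / k) = (\<Prod>i=1..N. (x i ^ l i) powr (1 / k))"
    unfolding mpow_def by (rule prod_powr_distrib)
  also have "\<dots> = (\<Prod>i=1..N. rpow (x i) (real (l i) / k))"
  proof (intro prod.cong refl)
    fix i assume "i \<in> {1..N}"
    then have "0 \<le> x i" using x by (auto simp: cone_B_def)
    then show "(x i ^ l i) powr (1 / k) = rpow (x i) (real (l i) / k)"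
      using k by (cases "x i = 0") (auto simp: rpow_def powr_powr simp flip: powr_realpow)
  qed
  finally show ?thesis by simp
qed

theorem theorem3p2:
  fixes k2 :: real and N :: nat and lam :: "real \<Rightarrow> nat \<Rightarrow> nat"
  assumes "k2 > 0"
    and "\<And>k. k > 0 \<Longrightarrow> lam k \<in> partitions N"
    and "\<And>i. i \<in> {1..N} \<Longrightarrow> bounded ((\<lambda>k. real (lam k i) / k) ` {0<..})"
  shows "\<forall>x0\<in>cone_B N. \<exists>U. open U \<and> x0 \<in> U \<and>
    uniform_limit (U \<inter> cone_B N)
      (\<lambda>k x. jack N (1 / k2) (lam k) x powr (1 / k)
             - (\<Prod>i=1..N. rpow (x i) (real (lam k i) / k)))
      (\<lambda>x. 0) at_top"
proof
  fix x0 assume x0: "x0 \<in> cone_B N"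
  obtain b where b: "\<And>i k. i \<in> {1..N} \<Longrightarrow> k > 0 \<Longrightarrow> real (lam k i) / k \<le> b i"
  proof -
    have "\<forall>i\<in>{1..N}. \<exists>B. \<forall>k>0. real (lam k i) / k \<le> B"
    proof
      fix i assume "i \<in> {1..N}"
      from assms(3)[OF this] obtain B where "\<And>k. k > 0 \<Longrightarrow> norm (real (lam k i) / k) \<le> B"
        by (auto simp: bounded_iff)
      then show "\<exists>B. \<forall>k>0. real (lam k i) / k \<le> B" by (intro exI[of _ B]) fastforce
    qed
    then show ?thesis using that by metis
  qed
  define D where "D = \<bar>\<Sum>i=1..N. b i\<bar> + 1"
  have D: "D > 0" by (simp add: D_def)
  have w: "real (weight N (lam k)) \<le> D * k" if "k > 0" for k
  proof -
    have "real (weight N (lam k)) / k = (\<Sum>i=1..N. real (lam k i) / k)"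
      by (simp add: weight_def sum_divide_distrib)
    also have "\<dots> \<le> (\<Sum>i=1..N. b i)" using b that by (intro sum_mono) auto
    also have "\<dots> \<le> D" by (simp add: D_def)
    finally show ?thesis using that by (simp add: pos_divide_le_eq)
  qed
  obtain p :: nat where "max 1 (2 * k2 * real N ^ 2) \<le> real p" using real_arch_simple by blast
  then have p: "p \<ge> 1" "2 * k2 * real N ^ 2 \<le> real (Suc p)" by auto
  define q where "q = real (N + 2 * p)"
  \<comment> \<open>A bound for all coordinates of the points of \<open>U\<close> in the cone; it is at least \<open>1\<close>, so that powers
    of \<open>R\<close> increase with the exponent.\<close>
  define R where "R = 1 + (\<Sum>i=1..N. x0 i)"
  have x0_nonneg: "0 \<le> x0 i" if "i \<in> {1..N}" for i using x0 that by (auto simp: cone_B_def)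
  have "0 \<le> (\<Sum>i=1..N. x0 i)" using x0_nonneg by (intro sum_nonneg)
  then have R1: "R \<ge> 1" by (simp add: R_def)
  define U where "U = {x :: nat \<Rightarrow> real. \<forall>i\<in>{1..N}. x i < x0 i + 1}"
  have "U = (\<Inter>i\<in>{1..N}. {x. x i < x0 i + 1})" by (auto simp: U_def)
  then have "open U" by (auto intro!: open_INT open_Collect_less continuous_intros)
  define g where "g k = R powr D * ((D * k + 1) powr (q / k) - 1)" for k
  have g: "(g \<longlongrightarrow> 0) at_top"
    unfolding g_def using D by real_asymp
  have main: "\<bar>jack N (1 / k2) (lam k) x powr (1 / k) - (\<Prod>i=1..N. rpow (x i) (real (lam k i) / k))\<bar> \<le> g k"
    if k: "k > 0" and x: "x \<in> U \<inter> cone_B N" for k x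
  proof -
    define n where "n = weight N (lam k)"
    define X where "X = mpow N (lam k) x"
    define J where "J = jack_sum N k2 (lam k) x"
    have xc: "x \<in> cone_B N" using x by simp
    have l: "lam k \<in> partitions N" using assms(2) k by simp
    have X0: "0 \<le> X" unfolding X_def using mpow_nonneg[OF xc] .
    have lo: "X \<le> J" unfolding X_def J_def using jack_sum_ge[OF l _ xc] assms(1) by simp
    have hi: "J \<le> (real n + 1) ^ (N + 2 * p) * X"
      unfolding X_def J_def n_def using jack_sum_le[OF l _ xc p] assms(1) by simp
    have "X \<le> (\<Prod>i=1..N. R ^ lam k i)"
      unfolding X_def mpow_def
    proof (intro prod_mono conjI power_mono)
      fix i assume i: "i \<in> {1..N}"
      show xi: "0 \<le> x i" using xc i by (auto simp: cone_B_def)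
      then show "0 \<le> x i ^ lam k i" by simp
      have "x0 i \<le> (\<Sum>i=1..N. x0 i)" using x0_nonneg i by (intro member_le_sum) auto
      then show "x i \<le> R" using x i unfolding U_def R_def by fastforce
    qed
    also have "\<dots> = R ^ n" by (simp add: n_def weight_def power_sum)
    also have "\<dots> = R powr real n" using R1 by (simp add: powr_realpow)
    finally have "X powr (1 / k) \<le> (R powr real n) powr (1 / k)" using X0 k by (intro powr_mono2) auto
    also have "\<dots> = R powr (real n / k)" by (simp add: powr_powr)
    also have "\<dots> \<le> R powr D"
      using R1 w[OF k] k by (intro powr_mono) (auto simp: n_def pos_divide_le_eq)
    finally have XR: "X powr (1 / k) \<le> R powr D" .
    have "J powr (1 / k) \<le> ((real n + 1) ^ (N + 2 * p) * X) powr (1 / k)"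
      using hi lo X0 k by (intro powr_mono2) auto
    also have "\<dots> = (real n + 1) powr (q / k) * X powr (1 / k)"
      using X0 by (simp add: powr_mult powr_powr q_def flip: powr_realpow)
    also have "\<dots> \<le> (D * k + 1) powr (q / k) * X powr (1 / k)"
      using w[OF k] k by (intro mult_right_mono powr_mono2) (auto simp: n_def q_def)
    finally have "J powr (1 / k) - X powr (1 / k) \<le> X powr (1 / k) * ((D * k + 1) powr (q / k) - 1)"
      by (simp add: algebra_simps)
    also have "\<dots> \<le> g k"
    proof -
      have "1 \<le> (D * k + 1) powr (q / k)" using D k by (intro ge_one_powr_ge_zero) (auto simp: q_def)
      then show ?thesis unfolding g_def using XR by (intro mult_right_mono) auto
    qed
    finally have up: "J powr (1 / k) - X powr (1 / k) \<le> g k" .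
    have "X powr (1 / k) \<le> J powr (1 / k)" using lo X0 k by (intro powr_mono2) auto
    moreover have "jack N (1 / k2) (lam k) x = J"
      using jack_eq_jack_sum[OF l, of "1 / k2"] assms(1) by (simp add: J_def)
    moreover have "(\<Prod>i=1..N. rpow (x i) (real (lam k i) / k)) = X powr (1 / k)"
      unfolding X_def by (rule prod_rpow_eq[OF xc k])
    ultimately show ?thesis using up by simp
  qed
  have "uniform_limit (U \<inter> cone_B N)
      (\<lambda>k x. jack N (1 / k2) (lam k) x powr (1 / k)
             - (\<Prod>i=1..N. rpow (x i) (real (lam k i) / k)))
      (\<lambda>x. 0) at_top"
  proof (rule uniform_limitI)
    fix e :: real assume "e > 0"
    then have "\<forall>\<^sub>F k in at_top. g k < e" using g by (rule order_tendstoD(2)[rotated])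
    then show "\<forall>\<^sub>F k in at_top. \<forall>x\<in>U \<inter> cone_B N.
        dist (jack N (1 / k2) (lam k) x powr (1 / k) - (\<Prod>i=1..N. rpow (x i) (real (lam k i) / k))) 0 < e"
      using eventually_gt_at_top[of 0]
    proof eventually_elim
      case (elim k)
      then show ?case using main by (fastforce simp: dist_real_def)
    qed
  qed
  with \<open>open U\<close> show "\<exists>U. open U \<and> x0 \<in> U \<and>
    uniform_limit (U \<inter> cone_B N)
      (\<lambda>k x. jack N (1 / k2) (lam k) x powr (1 / k)
             - (\<Prod>i=1..N. rpow (x i) (real (lam k i) / k)))
      (\<lambda>x. 0) at_top"
    by (intro exI[of _ U]) (auto simp: U_def)
qed

end
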